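(* Let $S$ be a unital inverse semigroup, let $K_{par}(S)$ be its partial semigroup algebra, and let $\iota_S: S\to K_{par}(S)$, $s\mapsto [s]$, be the canonical partial representation. Let $J$ be the ideal of $K_{par}(S)$ generated by all elements $a[s]-a[t]$ with $a\in K_{par}(S)$ and $s,t\in S$, $s\le t$; let $\widetilde{\iota}_S: S\to K_{par}(S)/J$ be the composition of $\iota_S$ with the quotient map; let $\mathsf{A}$ be the subalgebra of $K_{par}(S)/J$ generated by all elements $\widetilde{\varepsilon}_s=\widetilde{\iota}_S(s)\widetilde{\iota}_S(s^* )$, $s\in S$; and let $\alpha=\alpha^{\widetilde{\iota}_S}$ be the partial action of $S$ on $\mathsf{A}$ given by $X_s=\widetilde{\varepsilon}_s\mathsf{A}$ and $\alpha_s: X_{s^*}\to X_s$, $\alpha_s(a)=\widetilde{\iota}_S(s)\,a\,\widetilde{\iota}_S(s^* )$. Then the map $$\phi_{\widetilde{\iota}_S}: \mathsf{A}\times_{\alpha} S\to K_{par}(S)/J,\qquad \sum_{s\in S}a_s\delta_s\mapsto \sum_{s\in S}a_s\,\widetilde{\iota}_S(s),$$ is an isomorphism of $K$-algebras.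
   Context: $K$ is a fixed base field; algebras are $K$-algebras, and ideals are two-sided. $S$ is an inverse semigroup with identity $1$; $s^*$ denotes the inverse of $s$, and $s\le t$ is the natural partial order on $S$ ($s\le t$ iff $s=te$ for some idempotent $e\in S$). Partial representation: a partial representation of $S$ on a unital associative algebra $\mathsf{B}$ is a map $\pi:S\to\mathsf{B}$ such that for all $s,t\in S$: $\pi(s^* )\pi(s)\pi(t)=\pi(s^* )\pi(st)$, $\pi(s)\pi(t)\pi(t^* )=\pi(st)\pi(t^* )$, and $\pi(s)\pi(s^* )\pi(s)=\pi(s)$. Partial semigroup algebra: $\mathrm{Pr}(S)$ is the universal semigroup generated by symbols $[s]$, $s\in S$, subject to the relations $[s^*][s][t]=[s^*][st]$, $[s][t][t^*]=[st][t^*]$, $[s][s^*][s]=[s]$ for all $s,t\in S$. $K_{par}(S):=K\,\mathrm{Pr}(S)$ is its semigroup algebra over $K$ (it is unital with unit $[1]$). Partial action: a partial action $\alpha$ of $S$ on an associative algebra $\mathsf{A}$ consists of ideals $X_s$ of $\mathsf{A}$ ($s\in S$) and algebra isomorphisms $\alpha_s: X_{s^*}\to X_s$ such that for all $s,t\in S$: (1) $\alpha_s^{-1}=\alpha_{s^*}$; (2) $\alpha_s(X_{s^*}\cap X_t)=X_s\cap X_{st}$; (3) $\alpha_s(\alpha_t(x))=\alpha_{st}(x)$ for all $x\in X_{t^*}\cap X_{t^*s^*}$. (It follows that $X_r\subseteq X_t$ whenever $r\le t$.) Algebraic crossed product: let $L=\{\sum_{s\in S} a_s\delta_s : a_s\in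 X_s\}$ be the set of all formal finite sums (direct sum of the spaces $X_s\delta_s$), with the bilinear multiplication determined by $(a_s\delta_s)(b_t\delta_t)=\alpha_s(\alpha_{s^*}(a_s)b_t)\delta_{st}$. Let $I$ be the two-sided ideal of $L$ generated by $\{a\delta_r-a\delta_t : r\le t,\ a\in X_r\}$. Then $\mathsf{A}\times_\alpha S:=L/I$, and the class of $a_s\delta_s$ in $L/I$ is again written $a_s\delta_s$. *)

theory Defs
  imports "HOL-Algebra.Module" "HOL-Algebra.QuotRing"
begin

section \<open>Unital inverse semigroups\<close>

locale inverse_monoid = monoid S for S (structure) +
  assumes ex1_inverse:
    "s \<in> carrier S \<Longrightarrow>
      \<exists>!t. t \<in> carrier S \<and> s \<otimes> t \<otimes> s = s \<and> t \<otimes> s \<otimes> t = t"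

text \<open>The inverse of an inverse semigroup, as opposed to the library's group-like
  \<^const>\<open>m_inv\<close>.\<close>

definition star :: "('s, 'm) monoid_scheme \<Rightarrow> 's \<Rightarrow> 's" where
  "star S s = (THE t. t \<in> carrier S \<and> s \<otimes>\<^bsub>S\<^esub> t \<otimes>\<^bsub>S\<^esub> s = s \<and> t \<otimes>\<^bsub>S\<^esub> s \<otimes>\<^bsub>S\<^esub> t = t)"

definition nat_le :: "('s, 'm) monoid_scheme \<Rightarrow> 's \<Rightarrow> 's \<Rightarrow> bool" where
  "nat_le S s t \<longleftrightarrow> (\<exists>e \<in> carrier S. e \<otimes>\<^bsub>S\<^esub> e = e \<and> s = t \<otimes>\<^bsub>S\<^esub> e)"


section \<open>Algebras over a field\<close>

text \<open>An algebra over \<open>K\<close> is carried by the library's record \<^type>\<open>module\<close>. The locale below does not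
  ask for a unit, so that the field \<^const>\<open>one\<close> of the record is meaningful only for unital
  algebras; none of the notions of ideal, subalgebra and isomorphism refers to it.\<close>

locale assoc_algebra = K?: field K + A?: module K A for K (structure) and A (structure) +
  assumes alg_m_closed:
      "\<lbrakk>x \<in> carrier A; y \<in> carrier A\<rbrakk> \<Longrightarrow> x \<otimes>\<^bsub>A\<^esub> y \<in> carrier A"
    and alg_m_assoc:
      "\<lbrakk>x \<in> carrier A; y \<in> carrier A; z \<in> carrier A\<rbrakk> \<Longrightarrow>
        (x \<otimes>\<^bsub>A\<^esub> y) \<otimes>\<^bsub>A\<^esub> z = x \<otimes>\<^bsub>A\<^esub> (y \<otimes>\<^bsub>A\<^esub> z)"
    and alg_l_distr:
      "\<lbrakk>x \<in> carrier A; y \<in> carrier A; z \<in> carrier A\<rbrakk> \<Longrightarrow>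
        (x \<oplus>\<^bsub>A\<^esub> y) \<otimes>\<^bsub>A\<^esub> z = x \<otimes>\<^bsub>A\<^esub> z \<oplus>\<^bsub>A\<^esub> y \<otimes>\<^bsub>A\<^esub> z"
    and alg_r_distr:
      "\<lbrakk>x \<in> carrier A; y \<in> carrier A; z \<in> carrier A\<rbrakk> \<Longrightarrow>
        z \<otimes>\<^bsub>A\<^esub> (x \<oplus>\<^bsub>A\<^esub> y) = z \<otimes>\<^bsub>A\<^esub> x \<oplus>\<^bsub>A\<^esub> z \<otimes>\<^bsub>A\<^esub> y"
    and alg_smult_l:
      "\<lbrakk>c \<in> carrier K; x \<in> carrier A; y \<in> carrier A\<rbrakk> \<Longrightarrow>
        (c \<odot>\<^bsub>A\<^esub> x) \<otimes>\<^bsub>A\<^esub> y = c \<odot>\<^bsub>A\<^esub> (x \<otimes>\<^bsub>A\<^esub> y)"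
    and alg_smult_r:
      "\<lbrakk>c \<in> carrier K; x \<in> carrier A; y \<in> carrier A\<rbrakk> \<Longrightarrow>
        x \<otimes>\<^bsub>A\<^esub> (c \<odot>\<^bsub>A\<^esub> y) = c \<odot>\<^bsub>A\<^esub> (x \<otimes>\<^bsub>A\<^esub> y)"

text \<open>The library's \<^const>\<open>ideal\<close> and \<^const>\<open>genideal\<close> require an associative unital ring,
  which is too much for the algebra \<open>L\<close> in the construction of a crossed product.\<close>

definition alg_ideal :: "('k, 'm) ring_scheme \<Rightarrow> ('k, 'a, 'n) module_scheme \<Rightarrow> 'a set \<Rightarrow> bool" where
  "alg_ideal K A I \<longleftrightarrow> submodule I K A \<and>
     (\<forall>a \<in> carrier A. \<forall>x \<in> I. a \<otimes>\<^bsub>A\<^esub> x \<in> I \<and> x \<otimes>\<^bsub>A\<^esub> a \<in> I)"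

definition gen_alg_ideal ::
    "('k, 'm) ring_scheme \<Rightarrow> ('k, 'a, 'n) module_scheme \<Rightarrow> 'a set \<Rightarrow> 'a set" where
  "gen_alg_ideal K A E = \<Inter>{I. alg_ideal K A I \<and> E \<subseteq> I}"

definition alg_subalgebra ::
    "('k, 'm) ring_scheme \<Rightarrow> ('k, 'a, 'n) module_scheme \<Rightarrow> 'a set \<Rightarrow> bool" where
  "alg_subalgebra K A B \<longleftrightarrow> submodule B K A \<and> (\<forall>x \<in> B. \<forall>y \<in> B. x \<otimes>\<^bsub>A\<^esub> y \<in> B)"

definition gen_alg_subalgebra ::
    "('k, 'm) ring_scheme \<Rightarrow> ('k, 'a, 'n) module_scheme \<Rightarrow> 'a set \<Rightarrow> 'a set" where
  "gen_alg_subalgebra K A E = \<Inter>{B. alg_subalgebra K A B \<and> E \<subseteq> B}"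

text \<open>The ring part is the library's \<^const>\<open>FactRing\<close>, and scalars act on cosets in the same way as
  \<^const>\<open>rcoset_mult\<close> multiplies them.\<close>

definition quot_algebra :: "('k, 'a, 'n) module_scheme \<Rightarrow> 'a set \<Rightarrow> ('k, 'a set) module" where
  "quot_algebra A I =
    \<lparr>carrier = carrier (A Quot I), mult = mult (A Quot I), one = one (A Quot I),
     zero = zero (A Quot I), add = add (A Quot I),
     smult = (\<lambda>c X. \<Union>x\<in>X. I +>\<^bsub>A\<^esub> (c \<odot>\<^bsub>A\<^esub> x))\<rparr>"

text \<open>Isomorphisms of not necessarily unital algebras. When the algebras are unital, a bijective
  multiplicative map preserves the unit.\<close>

definition alg_iso ::
    "('k, 'm) ring_scheme \<Rightarrow> ('k, 'a, 'n) module_scheme \<Rightarrow> ('k, 'b, 'p) module_scheme \<Rightarrow> ('a \<Rightarrow> 'b) set"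
  where
  "alg_iso K A B = {h. bij_betw h (carrier A) (carrier B) \<and>
     (\<forall>x \<in> carrier A. \<forall>y \<in> carrier A. h (x \<oplus>\<^bsub>A\<^esub> y) = h x \<oplus>\<^bsub>B\<^esub> h y) \<and>
     (\<forall>x \<in> carrier A. \<forall>y \<in> carrier A. h (x \<otimes>\<^bsub>A\<^esub> y) = h x \<otimes>\<^bsub>B\<^esub> h y) \<and>
     (\<forall>c \<in> carrier K. \<forall>x \<in> carrier A. h (c \<odot>\<^bsub>A\<^esub> x) = c \<odot>\<^bsub>B\<^esub> h x)}"


section \<open>Partial representations and the partial semigroup algebra\<close>

definition partial_rep ::
    "('s, 'm) monoid_scheme \<Rightarrow> ('b, 'n) monoid_scheme \<Rightarrow> ('s \<Rightarrow> 'b) \<Rightarrow> bool" where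
  "partial_rep S B \<pi> \<longleftrightarrow> \<pi> \<in> carrier S \<rightarrow> carrier B \<and>
     (\<forall>s \<in> carrier S. \<forall>t \<in> carrier S.
        \<pi> (star S s) \<otimes>\<^bsub>B\<^esub> \<pi> s \<otimes>\<^bsub>B\<^esub> \<pi> t = \<pi> (star S s) \<otimes>\<^bsub>B\<^esub> \<pi> (s \<otimes>\<^bsub>S\<^esub> t) \<and>
        \<pi> s \<otimes>\<^bsub>B\<^esub> \<pi> t \<otimes>\<^bsub>B\<^esub> \<pi> (star S t) = \<pi> (s \<otimes>\<^bsub>S\<^esub> t) \<otimes>\<^bsub>B\<^esub> \<pi> (star S t) \<and>
        \<pi> s \<otimes>\<^bsub>B\<^esub> \<pi> (star S s) \<otimes>\<^bsub>B\<^esub> \<pi> s = \<pi> s)"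

text \<open>\<open>Pr(S)\<close> is the free semigroup of nonempty words over \<open>S\<close> modulo the congruence generated by
  the defining relations.\<close>

definition words :: "('s, 'm) monoid_scheme \<Rightarrow> 's list set" where
  "words S = lists (carrier S) - {[]}"

inductive pr_eq :: "('s, 'm) monoid_scheme \<Rightarrow> 's list \<Rightarrow> 's list \<Rightarrow> bool" for S where
  rel_left: "\<lbrakk>s \<in> carrier S; t \<in> carrier S\<rbrakk> \<Longrightarrow>
    pr_eq S [star S s, s, t] [star S s, s \<otimes>\<^bsub>S\<^esub> t]"
| rel_right: "\<lbrakk>s \<in> carrier S; t \<in> carrier S\<rbrakk> \<Longrightarrow>
    pr_eq S [s, t, star S t] [s \<otimes>\<^bsub>S\<^esub> t, star S t]"
| rel_regular: "s \<in> carrier S \<Longrightarrow> pr_eq S [s, star S s, s] [s]"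
| refl: "u \<in> words S \<Longrightarrow> pr_eq S u u"
| sym: "pr_eq S u v \<Longrightarrow> pr_eq S v u"
| trans: "\<lbrakk>pr_eq S u v; pr_eq S v w\<rbrakk> \<Longrightarrow> pr_eq S u w"
| append: "\<lbrakk>pr_eq S u v; pr_eq S x y\<rbrakk> \<Longrightarrow> pr_eq S (u @ x) (v @ y)"

definition pr_class :: "('s, 'm) monoid_scheme \<Rightarrow> 's list \<Rightarrow> 's list set" where
  "pr_class S u = {v. pr_eq S u v}"

definition Pr :: "('s, 'm) monoid_scheme \<Rightarrow> 's list set monoid" where
  "Pr S = \<lparr>carrier = words S // {(u, v). pr_eq S u v},
           mult = (\<lambda>X Y. \<Union>u\<in>X. \<Union>v\<in>Y. pr_class S (u @ v)),
           one = pr_class S [\<one>\<^bsub>S\<^esub>]\<rparr>"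

text \<open>The finitely supported function that is \<open>a\<close> at \<open>x\<close>; the zero is taken from the ring of values.\<close>

definition single_at :: "('a, 'm) ring_scheme \<Rightarrow> 'a \<Rightarrow> 'x \<Rightarrow> 'x \<Rightarrow> 'a" where
  "single_at R a x = (\<lambda>y. if y = x then a else \<zero>\<^bsub>R\<^esub>)"

text \<open>The semigroup algebra of a semigroup \<open>P\<close> whose identity is \<open>\<one>\<^bsub>P\<^esub>\<close>: finitely
  supported functions (extended by zero outside \<open>P\<close>) with convolution.\<close>

definition semigroup_algebra ::
    "('k, 'm) ring_scheme \<Rightarrow> ('p, 'n) monoid_scheme \<Rightarrow> ('k, 'p \<Rightarrow> 'k) module" where
  "semigroup_algebra K P =
    \<lparr>carrier = {f. (\<forall>p \<in> carrier P. f p \<in> carrier K) \<and> (\<forall>p. p \<notin> carrier P \<longrightarrow> f p = \<zero>\<^bsub>K\<^esub>) \<and>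
                   finite {p. f p \<noteq> \<zero>\<^bsub>K\<^esub>}},
     mult = (\<lambda>f g r. finsum K (\<lambda>(p, q). f p \<otimes>\<^bsub>K\<^esub> g q)
                {(p, q). f p \<noteq> \<zero>\<^bsub>K\<^esub> \<and> g q \<noteq> \<zero>\<^bsub>K\<^esub> \<and> p \<otimes>\<^bsub>P\<^esub> q = r}),
     one = single_at K \<one>\<^bsub>K\<^esub> \<one>\<^bsub>P\<^esub>,
     zero = (\<lambda>p. \<zero>\<^bsub>K\<^esub>),
     add = (\<lambda>f g p. f p \<oplus>\<^bsub>K\<^esub> g p),
     smult = (\<lambda>c f p. c \<otimes>\<^bsub>K\<^esub> f p)\<rparr>"

definition Kpar ::
    "('k, 'n) ring_scheme \<Rightarrow> ('s, 'm) monoid_scheme \<Rightarrow> ('k, 's list set \<Rightarrow> 'k) module" where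
  "Kpar K S = semigroup_algebra K (Pr S)"

definition iota ::
    "('k, 'n) ring_scheme \<Rightarrow> ('s, 'm) monoid_scheme \<Rightarrow> 's \<Rightarrow> 's list set \<Rightarrow> 'k" where
  "iota K S s = single_at K \<one>\<^bsub>K\<^esub> (pr_class S [s])"

definition J_ideal ::
    "('k, 'n) ring_scheme \<Rightarrow> ('s, 'm) monoid_scheme \<Rightarrow> ('s list set \<Rightarrow> 'k) set" where
  "J_ideal K S = gen_alg_ideal K (Kpar K S)
     {a \<otimes>\<^bsub>Kpar K S\<^esub> iota K S s \<ominus>\<^bsub>Kpar K S\<^esub> a \<otimes>\<^bsub>Kpar K S\<^esub> iota K S t | a s t.
        a \<in> carrier (Kpar K S) \<and> s \<in> carrier S \<and> t \<in> carrier S \<and> nat_le S s t}"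

definition Kpar_quot ::
    "('k, 'n) ring_scheme \<Rightarrow> ('s, 'm) monoid_scheme \<Rightarrow> ('k, ('s list set \<Rightarrow> 'k) set) module" where
  "Kpar_quot K S = quot_algebra (Kpar K S) (J_ideal K S)"

definition iota_quot ::
    "('k, 'n) ring_scheme \<Rightarrow> ('s, 'm) monoid_scheme \<Rightarrow> 's \<Rightarrow> ('s list set \<Rightarrow> 'k) set" where
  "iota_quot K S s = J_ideal K S +>\<^bsub>Kpar K S\<^esub> iota K S s"


section \<open>Partial actions and crossed products\<close>

locale partial_action = S?: inverse_monoid S + assoc_algebra K A
  for K (structure) and S (structure) and A (structure)
    and X :: "'s \<Rightarrow> 'a set" and \<alpha> :: "'s \<Rightarrow> 'a \<Rightarrow> 'a" +
  assumes pa_ideal: "s \<in> carrier S \<Longrightarrow> alg_ideal K A (X s)"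
    and pa_iso: "s \<in> carrier S \<Longrightarrow>
      \<alpha> s \<in> alg_iso K (A\<lparr>carrier := X (star S s)\<rparr>) (A\<lparr>carrier := X s\<rparr>)"
    and pa_inv: "\<lbrakk>s \<in> carrier S; x \<in> X s\<rbrakk> \<Longrightarrow>
      inv_into (X (star S s)) (\<alpha> s) x = \<alpha> (star S s) x"
    and pa_image: "\<lbrakk>s \<in> carrier S; t \<in> carrier S\<rbrakk> \<Longrightarrow>
      \<alpha> s ` (X (star S s) \<inter> X t) = X s \<inter> X (s \<otimes>\<^bsub>S\<^esub> t)"
    and pa_comp: "\<lbrakk>s \<in> carrier S; t \<in> carrier S;
        x \<in> X (star S t) \<inter> X (star S t \<otimes>\<^bsub>S\<^esub> star S s)\<rbrakk> \<Longrightarrow>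
      \<alpha> s (\<alpha> t x) = \<alpha> (s \<otimes>\<^bsub>S\<^esub> t) x"

text \<open>The algebra \<open>L\<close> of formal sums \<open>\<Sum>a\<^sub>s\<delta>\<^sub>s\<close>, encoded as the function \<open>s \<mapsto> a\<^sub>s\<close>
  (extended by zero outside \<open>S\<close>). The entry for \<^const>\<open>one\<close>, namely \<open>\<one>\<delta>\<^sub>\<one>\<close>, is relevant
  only if \<open>A\<close> is unital.\<close>

definition formal_sums ::
    "('s, 'm) monoid_scheme \<Rightarrow> ('k, 'a, 'n) module_scheme \<Rightarrow> ('s \<Rightarrow> 'a set) \<Rightarrow> ('s \<Rightarrow> 'a \<Rightarrow> 'a)
      \<Rightarrow> ('k, 's \<Rightarrow> 'a) module" where
  "formal_sums S A X \<alpha> =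
    \<lparr>carrier = {f. (\<forall>s \<in> carrier S. f s \<in> X s) \<and> (\<forall>s. s \<notin> carrier S \<longrightarrow> f s = \<zero>\<^bsub>A\<^esub>) \<and>
                   finite {s. f s \<noteq> \<zero>\<^bsub>A\<^esub>}},
     mult = (\<lambda>f g r. finsum A (\<lambda>(s, t). \<alpha> s (\<alpha> (star S s) (f s) \<otimes>\<^bsub>A\<^esub> g t))
                {(s, t). f s \<noteq> \<zero>\<^bsub>A\<^esub> \<and> g t \<noteq> \<zero>\<^bsub>A\<^esub> \<and> s \<otimes>\<^bsub>S\<^esub> t = r}),
     one = single_at A \<one>\<^bsub>A\<^esub> \<one>\<^bsub>S\<^esub>,
     zero = (\<lambda>s. \<zero>\<^bsub>A\<^esub>),
     add = (\<lambda>f g s. f s \<oplus>\<^bsub>A\<^esub> g s),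
     smult = (\<lambda>c f s. c \<odot>\<^bsub>A\<^esub> f s)\<rparr>"

definition crossed_ideal ::
    "('k, 'p) ring_scheme \<Rightarrow> ('s, 'm) monoid_scheme \<Rightarrow> ('k, 'a, 'n) module_scheme
      \<Rightarrow> ('s \<Rightarrow> 'a set) \<Rightarrow> ('s \<Rightarrow> 'a \<Rightarrow> 'a) \<Rightarrow> ('s \<Rightarrow> 'a) set" where
  "crossed_ideal K S A X \<alpha> = gen_alg_ideal K (formal_sums S A X \<alpha>)
     {single_at A a r \<ominus>\<^bsub>formal_sums S A X \<alpha>\<^esub> single_at A a t | a r t.
        r \<in> carrier S \<and> t \<in> carrier S \<and> nat_le S r t \<and> a \<in> X r}"

definition crossed_product ::
    "('k, 'p) ring_scheme \<Rightarrow> ('s, 'm) monoid_scheme \<Rightarrow> ('k, 'a, 'n) module_scheme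
      \<Rightarrow> ('s \<Rightarrow> 'a set) \<Rightarrow> ('s \<Rightarrow> 'a \<Rightarrow> 'a) \<Rightarrow> ('k, ('s \<Rightarrow> 'a) set) module" where
  "crossed_product K S A X \<alpha> = quot_algebra (formal_sums S A X \<alpha>) (crossed_ideal K S A X \<alpha>)"


section \<open>The partial action induced by a partial representation\<close>

definition rep_eps ::
    "('s, 'm) monoid_scheme \<Rightarrow> ('b, 'n) monoid_scheme \<Rightarrow> ('s \<Rightarrow> 'b) \<Rightarrow> 's \<Rightarrow> 'b" where
  "rep_eps S B \<pi> s = \<pi> s \<otimes>\<^bsub>B\<^esub> \<pi> (star S s)"

definition rep_alg ::
    "('k, 'p) ring_scheme \<Rightarrow> ('s, 'm) monoid_scheme \<Rightarrow> ('k, 'b, 'n) module_scheme \<Rightarrow> ('s \<Rightarrow> 'b)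
      \<Rightarrow> ('k, 'b, 'n) module_scheme" where
  "rep_alg K S B \<pi> = B\<lparr>carrier := gen_alg_subalgebra K B (rep_eps S B \<pi> ` carrier S)\<rparr>"

definition rep_dom ::
    "('k, 'p) ring_scheme \<Rightarrow> ('s, 'm) monoid_scheme \<Rightarrow> ('k, 'b, 'n) module_scheme \<Rightarrow> ('s \<Rightarrow> 'b)
      \<Rightarrow> 's \<Rightarrow> 'b set" where
  "rep_dom K S B \<pi> s = {rep_eps S B \<pi> s \<otimes>\<^bsub>B\<^esub> a | a. a \<in> carrier (rep_alg K S B \<pi>)}"

definition rep_act ::
    "('s, 'm) monoid_scheme \<Rightarrow> ('b, 'n) monoid_scheme \<Rightarrow> ('s \<Rightarrow> 'b) \<Rightarrow> 's \<Rightarrow> 'b \<Rightarrow> 'b" where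
  "rep_act S B \<pi> s a = \<pi> s \<otimes>\<^bsub>B\<^esub> a \<otimes>\<^bsub>B\<^esub> \<pi> (star S s)"

definition rep_sum ::
    "('b, 'n) ring_scheme \<Rightarrow> ('s \<Rightarrow> 'b) \<Rightarrow> ('s \<Rightarrow> 'b) \<Rightarrow> 'b" where
  "rep_sum B \<pi> f = finsum B (\<lambda>s. f s \<otimes>\<^bsub>B\<^esub> \<pi> s) {s. f s \<noteq> \<zero>\<^bsub>B\<^esub>}"

text \<open>The map induced on cosets, as in the library's first isomorphism theorem
  \<open>FactRing_iso\<close>: it has the intended value on the class of \<open>f\<close> precisely when
  \<^const>\<open>rep_sum\<close> is constant there.\<close>

definition rep_phi ::
    "('b, 'n) ring_scheme \<Rightarrow> ('s \<Rightarrow> 'b) \<Rightarrow> ('s \<Rightarrow> 'b) set \<Rightarrow> 'b" where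
  "rep_phi B \<pi> C = the_elem (rep_sum B \<pi> ` C)"

end

theory Submission
  imports Defs
begin

text \<open>Modulo \<open>J\<close> the canonical partial representation \<open>\<pi>\<close> takes equal values on comparable elements,
  so idempotents act trivially, \<open>\<epsilon>\<^sub>s\<close> depends only on the class of \<open>s\<close> under the minimum group
  congruence, and the partial action is essentially one of the maximal group image. The map
  \<open>\<Sum>a\<^sub>s\<delta>\<^sub>s \<mapsto> \<Sum>a\<^sub>s\<pi>(s)\<close> is onto because \<open>\<pi>(s)\<pi>(t) = \<epsilon>\<^sub>s\<epsilon>\<^bsub>st\<^esub>\<pi>(st)\<close>. For its kernel, note that
  multiplying out words grades \<open>Pr(S)\<close> by \<open>S\<close>; the generators of \<open>J\<close> are homogeneous for the induced
  grading by the maximal group image, which therefore passes to the quotient. So if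
  \<open>\<Sum>a\<^sub>s\<pi>(s) = 0\<close>, then the terms of each class already sum to zero; modulo the relations of the
  crossed product they collect into a single term \<open>a\<delta>\<^sub>s\<close> with \<open>a\<pi>(s) = 0\<close>, whence
  \<open>a = a\<epsilon>\<^sub>s = 0\<close>.\<close>

section \<open>Inverse monoids\<close>

text \<open>The grading of \<open>Pr S\<close> by \<open>S\<close> does not itself descend to the
  quotient, since a generator a[s] - a[t] of \<open>J\<close> mixes the degrees us and ut. These are
  comparable, so what is needed of a set of degrees is that it be closed upwards and downwards in
  the natural order. Such sets represent the subsets of the maximal group image without the group
  being formed, and the projections onto them obey a single rule: a right factor
  \<open>\<pi> s\<close> turns T into {u. us \<in> T}. Elements of \<open>A\<close> have the
  identity as degree, because \<epsilon>_s multiplies degrees by an idempotent, which changes no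
  membership in T; this is why a coefficient can be pulled out of a projection.

  A second obstacle is that the algebra \<open>L\<close> of formal sums is available here only as a
  module with a biadditive product. Its quotient is therefore handled through the fibres of the
  summation map, and the kernel is compared with the linear span of the relations.\<close>

context inverse_monoid
begin

section \<open>Inverses and commuting idempotents\<close>

abbreviation star_S ("_\<^sup>\<star>" [1000] 1000) where "s\<^sup>\<star> \<equiv> star S s"

lemma star_props:
  assumes "s \<in> carrier S"
  shows "s\<^sup>\<star> \<in> carrier S" "s \<otimes> s\<^sup>\<star> \<otimes> s = s" "s\<^sup>\<star> \<otimes> s \<otimes> s\<^sup>\<star> = s\<^sup>\<star>"
  using theI'[OF ex1_inverse[OF assms]] unfolding star_def by auto

lemmas star_closed [simp, intro] = star_props(1)

lemma star_eqI:
  assumes "s \<in> carrier S" "t \<in> carrier S" "s \<otimes> t \<otimes> s = s" "t \<otimes> s \<otimes> t = t"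
  shows "s\<^sup>\<star> = t"
  using ex1_inverse[OF assms(1)] star_props[OF assms(1)] assms by blast

lemma star_star [simp]: "s \<in> carrier S \<Longrightarrow> s\<^sup>\<star>\<^sup>\<star> = s"
  by (intro star_eqI) (auto simp: star_props)

lemma star_idem: "e \<in> carrier S \<Longrightarrow> e \<otimes> e = e \<Longrightarrow> e\<^sup>\<star> = e"
  by (intro star_eqI) auto

lemma star_one [simp]: "\<one>\<^sup>\<star> = \<one>"
  by (intro star_idem) auto

text \<open>Let x be the inverse of ef. The element fxe is an inverse of ef too, so x = fxe by
  uniqueness, and this makes x idempotent. An idempotent is its own inverse, hence x = ef.\<close>

lemma idem_mult_idem:
  assumes [simp]: "e \<in> carrier S" "f \<in> carrier S" and e: "e \<otimes> e = e" and f: "f \<otimes> f = f"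
  shows "e \<otimes> f \<otimes> (e \<otimes> f) = e \<otimes> f"
proof -
  define x where "x = (e \<otimes> f)\<^sup>\<star>"
  have x [simp]: "x \<in> carrier S" and x1: "e \<otimes> f \<otimes> x \<otimes> (e \<otimes> f) = e \<otimes> f"
    and x2: "x \<otimes> (e \<otimes> f) \<otimes> x = x"
    unfolding x_def by (auto simp: star_props)
  have ee: "e \<otimes> (e \<otimes> y) = e \<otimes> y" and ff: "f \<otimes> (f \<otimes> y) = f \<otimes> y" if "y \<in> carrier S" for y
    using that e f by (simp_all flip: m_assoc)
  have x2': "x \<otimes> (e \<otimes> (f \<otimes> (x \<otimes> y))) = x \<otimes> y" if "y \<in> carrier S" for y
    using arg_cong[OF x2, of "\<lambda>z. z \<otimes> y"] that by (simp add: m_assoc)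
  have "x = f \<otimes> x \<otimes> e" unfolding x_def
  proof (rule star_eqI)
    show "e \<otimes> f \<otimes> (f \<otimes> (e \<otimes> f)\<^sup>\<star> \<otimes> e) \<otimes> (e \<otimes> f) = e \<otimes> f"
      using x1 by (simp add: m_assoc ee ff flip: x_def)
    show "f \<otimes> (e \<otimes> f)\<^sup>\<star> \<otimes> e \<otimes> (e \<otimes> f) \<otimes> (f \<otimes> (e \<otimes> f)\<^sup>\<star> \<otimes> e) = f \<otimes> (e \<otimes> f)\<^sup>\<star> \<otimes> e"
      by (simp add: m_assoc ee ff x2' flip: x_def)
  qed auto
  then have "x \<otimes> x = (f \<otimes> x \<otimes> e) \<otimes> (f \<otimes> x \<otimes> e)" by simp
  also have "\<dots> = f \<otimes> x \<otimes> e" by (simp add: m_assoc x2')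
  also have "\<dots> = x" using \<open>x = f \<otimes> x \<otimes> e\<close> by simp
  finally have xx: "x \<otimes> x = x" .
  have "x = e \<otimes> f" using star_idem[OF x xx] unfolding x_def by simp
  then show ?thesis using xx by simp
qed

text \<open>Both fe and the idempotent ef itself are inverses of ef, so uniqueness of inverses
  identifies them.\<close>

lemma idem_commute:
  assumes [simp]: "e \<in> carrier S" "f \<in> carrier S" and e: "e \<otimes> e = e" and f: "f \<otimes> f = f"
  shows "e \<otimes> f = f \<otimes> e"
proof -
  have ee: "e \<otimes> (e \<otimes> y) = e \<otimes> y" and ff: "f \<otimes> (f \<otimes> y) = f \<otimes> y" if "y \<in> carrier S" for y
    using that e f by (simp_all flip: m_assoc)
  have "(e \<otimes> f)\<^sup>\<star> = f \<otimes> e"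
    using idem_mult_idem[OF assms] idem_mult_idem[OF assms(2,1) f e]
    by (intro star_eqI) (auto simp: m_assoc ee ff)
  moreover have "(e \<otimes> f)\<^sup>\<star> = e \<otimes> f"
    using idem_mult_idem[OF assms] by (intro star_idem) auto
  ultimately show ?thesis by simp
qed

lemma star_mult_self_idem:
  "s \<in> carrier S \<Longrightarrow> s \<otimes> s\<^sup>\<star> \<otimes> (s \<otimes> s\<^sup>\<star>) = s \<otimes> s\<^sup>\<star>"
  "s \<in> carrier S \<Longrightarrow> s\<^sup>\<star> \<otimes> s \<otimes> (s\<^sup>\<star> \<otimes> s) = s\<^sup>\<star> \<otimes> s"
  by (simp_all add: star_props flip: m_assoc)

text \<open>The idempotents \<open>s\<^sup>\<star> \<otimes> s\<close> and
  \<open>t \<otimes> t\<^sup>\<star>\<close> are neighbours in both products to be computed;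
  swapping them brings each factor together with its own inverse.\<close>

lemma star_mult:
  assumes [simp]: "s \<in> carrier S" "t \<in> carrier S"
  shows "(s \<otimes> t)\<^sup>\<star> = t\<^sup>\<star> \<otimes> s\<^sup>\<star>"
proof (rule star_eqI)
  have c: "s\<^sup>\<star> \<otimes> s \<otimes> (t \<otimes> t\<^sup>\<star>) = t \<otimes> t\<^sup>\<star> \<otimes> (s\<^sup>\<star> \<otimes> s)"
    by (intro idem_commute) (auto simp: star_mult_self_idem)
  have "s \<otimes> t \<otimes> (t\<^sup>\<star> \<otimes> s\<^sup>\<star>) \<otimes> (s \<otimes> t) = s \<otimes> (t \<otimes> t\<^sup>\<star> \<otimes> (s\<^sup>\<star> \<otimes> s)) \<otimes> t"
    by (simp add: m_assoc)
  also have "\<dots> = (s \<otimes> s\<^sup>\<star> \<otimes> s) \<otimes> (t \<otimes> t\<^sup>\<star> \<otimes> t)" by (simp add: m_assoc flip: c)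
  finally show "s \<otimes> t \<otimes> (t\<^sup>\<star> \<otimes> s\<^sup>\<star>) \<otimes> (s \<otimes> t) = s \<otimes> t" by (simp add: star_props)
  have "t\<^sup>\<star> \<otimes> s\<^sup>\<star> \<otimes> (s \<otimes> t) \<otimes> (t\<^sup>\<star> \<otimes> s\<^sup>\<star>) = t\<^sup>\<star> \<otimes> (s\<^sup>\<star> \<otimes> s \<otimes> (t \<otimes> t\<^sup>\<star>)) \<otimes> s\<^sup>\<star>"
    by (simp add: m_assoc)
  also have "\<dots> = (t\<^sup>\<star> \<otimes> t \<otimes> t\<^sup>\<star>) \<otimes> (s\<^sup>\<star> \<otimes> s \<otimes> s\<^sup>\<star>)" by (simp add: m_assoc c)
  finally show "t\<^sup>\<star> \<otimes> s\<^sup>\<star> \<otimes> (s \<otimes> t) \<otimes> (t\<^sup>\<star> \<otimes> s\<^sup>\<star>) = t\<^sup>\<star> \<otimes> s\<^sup>\<star>" by (simp add: star_props)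
qed auto

section \<open>The natural partial order\<close>

lemma nat_leI: "e \<in> carrier S \<Longrightarrow> e \<otimes> e = e \<Longrightarrow> s = t \<otimes> e \<Longrightarrow> nat_le S s t"
  unfolding nat_le_def by blast

lemma nat_leE:
  assumes "nat_le S s t"
  obtains e where "e \<in> carrier S" "e \<otimes> e = e" "s = t \<otimes> e"
  using assms unfolding nat_le_def by blast

text \<open>The order is defined by idempotents on the right; here e is carried across t as the
  idempotent \<open>t\<^sup>\<star> \<otimes> e \<otimes> t\<close>. This left-handed form is what
  makes the order compatible with right multiplication and with inversion.\<close>

lemma nat_le_idem_mult:
  assumes [simp]: "e \<in> carrier S" "t \<in> carrier S" and e: "e \<otimes> e = e"
  shows "nat_le S (e \<otimes> t) t"
proof -
  have c: "e \<otimes> (t \<otimes> t\<^sup>\<star>) = t \<otimes> t\<^sup>\<star> \<otimes> e"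
    by (intro idem_commute) (auto simp: star_mult_self_idem e)
  have "t\<^sup>\<star> \<otimes> e \<otimes> t \<otimes> (t\<^sup>\<star> \<otimes> e \<otimes> t) = t\<^sup>\<star> \<otimes> e \<otimes> (t \<otimes> t\<^sup>\<star> \<otimes> e) \<otimes> t" by (simp add: m_assoc)
  also have "\<dots> = t\<^sup>\<star> \<otimes> (e \<otimes> e) \<otimes> (t \<otimes> t\<^sup>\<star> \<otimes> t)" by (simp add: m_assoc flip: c)
  finally have "t\<^sup>\<star> \<otimes> e \<otimes> t \<otimes> (t\<^sup>\<star> \<otimes> e \<otimes> t) = t\<^sup>\<star> \<otimes> e \<otimes> t" by (simp add: e star_props)
  moreover have "t \<otimes> (t\<^sup>\<star> \<otimes> e \<otimes> t) = e \<otimes> (t \<otimes> t\<^sup>\<star> \<otimes> t)"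
    using arg_cong[OF c, of "\<lambda>z. z \<otimes> t"] by (simp add: m_assoc)
  ultimately show ?thesis
    by (intro nat_leI[of "t\<^sup>\<star> \<otimes> e \<otimes> t"]) (simp_all add: star_props)
qed

lemma nat_le_mult_idem: "e \<in> carrier S \<Longrightarrow> e \<otimes> e = e \<Longrightarrow> nat_le S (t \<otimes> e) t"
  by (auto intro: nat_leI)

lemma nat_le_trans:
  assumes [simp]: "t \<in> carrier S" and st: "nat_le S r s" "nat_le S s t"
  shows "nat_le S r t"
proof -
  obtain e f where [simp]: "e \<in> carrier S" "f \<in> carrier S" and e: "e \<otimes> e = e" "f \<otimes> f = f"
    "r = s \<otimes> e" "s = t \<otimes> f" using st by (elim nat_leE)
  then show ?thesis
    using idem_mult_idem[of f e] by (intro nat_leI[of "f \<otimes> e"]) (simp_all add: m_assoc)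
qed

lemma nat_le_mult_left:
  "nat_le S s t \<Longrightarrow> r \<in> carrier S \<Longrightarrow> t \<in> carrier S \<Longrightarrow> nat_le S (r \<otimes> s) (r \<otimes> t)"
  by (elim nat_leE, rule nat_leI) (auto simp: m_assoc)

lemma nat_le_mult_right:
  assumes "nat_le S s t" and [simp]: "r \<in> carrier S" "t \<in> carrier S"
  shows "nat_le S (s \<otimes> r) (t \<otimes> r)"
proof -
  obtain e where [simp]: "e \<in> carrier S" and e: "e \<otimes> e = e" "s = t \<otimes> e"
    using assms(1) by (elim nat_leE)
  show ?thesis
    using nat_le_mult_left[OF nat_le_idem_mult[of e r], of t] e by (simp add: m_assoc)
qed

text \<open>These are the unions of classes of the minimum group congruence, that is, the preimages
  of subsets of the maximal group image.\<close>

definition saturated :: "'a set \<Rightarrow> bool" where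
  "saturated T \<longleftrightarrow> T \<subseteq> carrier S \<and> (\<forall>s \<in> carrier S. \<forall>t \<in> carrier S. nat_le S s t \<longrightarrow> (s \<in> T \<longleftrightarrow> t \<in> T))"

lemma saturatedD:
  "saturated T \<Longrightarrow> nat_le S s t \<Longrightarrow> s \<in> carrier S \<Longrightarrow> t \<in> carrier S \<Longrightarrow> s \<in> T \<longleftrightarrow> t \<in> T"
  unfolding saturated_def by blast

text \<open>Translations are monotone and so pull saturated sets back to saturated sets. The
  pullbacks are the shifted degree sets that arise when a factor of degree s is split off.\<close>

lemma saturated_right_quot: "s \<in> carrier S \<Longrightarrow> saturated T \<Longrightarrow> saturated {u \<in> carrier S. u \<otimes> s \<in> T}"
  by (auto simp: saturated_def nat_le_mult_right)

lemma saturated_left_quot: "s \<in> carrier S \<Longrightarrow> saturated T \<Longrightarrow> saturated {u \<in> carrier S. s \<otimes> u \<in> T}"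
  by (auto simp: saturated_def nat_le_mult_left)

text \<open>The class of \<open>s\<close> under the minimum group congruence.\<close>

definition min_class :: "'a \<Rightarrow> 'a set" where
  "min_class s = {t \<in> carrier S. \<exists>r \<in> carrier S. nat_le S r s \<and> nat_le S r t}"

lemma nat_le_refl: "s \<in> carrier S \<Longrightarrow> nat_le S s s"
  by (rule nat_leI[of \<one>]) auto

lemma min_class_refl: "s \<in> carrier S \<Longrightarrow> s \<in> min_class s"
  unfolding min_class_def using nat_le_refl by blast

text \<open>Upwards this is transitivity. Downwards, if r lies below s and u, and t = ue, then re
  lies below s and t.\<close>

lemma saturated_min_class:
  assumes s: "s \<in> carrier S"
  shows "saturated (min_class s)"
  unfolding saturated_def
proof (intro conjI ballI impI iffI)
  show "min_class s \<subseteq> carrier S" by (auto simp: min_class_def)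
next
  fix t u assume [simp]: "t \<in> carrier S" "u \<in> carrier S" and tu: "nat_le S t u"
  show "u \<in> min_class s" if "t \<in> min_class s"
    using that tu nat_le_trans[of u _ t] unfolding min_class_def by auto
  show "t \<in> min_class s" if "u \<in> min_class s"
  proof -
    obtain e where [simp]: "e \<in> carrier S" and e: "e \<otimes> e = e" "t = u \<otimes> e"
      using tu by (elim nat_leE)
    obtain r where [simp]: "r \<in> carrier S" and r: "nat_le S r s" "nat_le S r u"
      using \<open>u \<in> min_class s\<close> unfolding min_class_def by blast
    have "nat_le S (r \<otimes> e) s" using nat_le_trans[OF s nat_le_mult_idem r(1)] e by simp
    moreover have "nat_le S (r \<otimes> e) t" using nat_le_mult_right[OF r(2)] e by simp
    ultimately show ?thesis unfolding min_class_def by auto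
  qed
qed

end


section \<open>Finitely supported functions and convolutions\<close>

lemma (in abelian_group) minus_minus_zero: "x \<in> carrier G \<Longrightarrow> x \<ominus> (x \<ominus> \<zero>) = \<zero>"
proof -
  have neg_zero: "\<ominus> \<zero> = \<zero>" by (rule minus_equality) simp_all
  show "x \<in> carrier G \<Longrightarrow> x \<ominus> (x \<ominus> \<zero>) = \<zero>" by (simp add: a_minus_def r_neg neg_zero)
qed

text \<open>The semigroup algebra and the algebra of formal sums are treated as one construction: a
  direct sum of additive groups \<open>D p\<close>, multiplied through products of the summands. For
  the former \<open>D\<close> is constantly the field, for the latter it is the family of ideals of
  the partial action.\<close>

definition fin_supp ::
    "('a, 'm) ring_scheme \<Rightarrow> 'p set \<Rightarrow> ('p \<Rightarrow> 'a set) \<Rightarrow> ('p \<Rightarrow> 'a) set" where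
  "fin_supp R P D = {f. (\<forall>p \<in> P. f p \<in> D p) \<and> (\<forall>p. p \<notin> P \<longrightarrow> f p = \<zero>\<^bsub>R\<^esub>) \<and> finite {p. f p \<noteq> \<zero>\<^bsub>R\<^esub>}}"

definition conv ::
    "('a, 'm) ring_scheme \<Rightarrow> ('p \<Rightarrow> 'p \<Rightarrow> 'p) \<Rightarrow> ('p \<Rightarrow> 'p \<Rightarrow> 'a \<Rightarrow> 'a \<Rightarrow> 'a)
      \<Rightarrow> ('p \<Rightarrow> 'a) \<Rightarrow> ('p \<Rightarrow> 'a) \<Rightarrow> 'p \<Rightarrow> 'a" where
  "conv R mul m f g r = finsum R (\<lambda>(p, q). m p q (f p) (g q))
     {(p, q). f p \<noteq> \<zero>\<^bsub>R\<^esub> \<and> g q \<noteq> \<zero>\<^bsub>R\<^esub> \<and> mul p q = r}"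

section \<open>Direct sums of additive subgroups as finitely supported functions\<close>

locale graded_family = abelian_group R for R (structure) +
  fixes P :: "'p set" and D :: "'p \<Rightarrow> 'a set"
  assumes D_subset: "p \<in> P \<Longrightarrow> D p \<subseteq> carrier R"
    and D_zero: "p \<in> P \<Longrightarrow> \<zero> \<in> D p"
    and D_add: "p \<in> P \<Longrightarrow> a \<in> D p \<Longrightarrow> b \<in> D p \<Longrightarrow> a \<oplus> b \<in> D p"
    and D_neg: "p \<in> P \<Longrightarrow> a \<in> D p \<Longrightarrow> \<ominus> a \<in> D p"
begin

abbreviation FS where "FS \<equiv> fin_supp R P D"

lemma D_carrier: "p \<in> P \<Longrightarrow> a \<in> D p \<Longrightarrow> a \<in> carrier R"
  using D_subset by blast

lemma FS_D: "f \<in> FS \<Longrightarrow> p \<in> P \<Longrightarrow> f p \<in> D p"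
  and FS_outside: "f \<in> FS \<Longrightarrow> p \<notin> P \<Longrightarrow> f p = \<zero>"
  and FS_finite: "f \<in> FS \<Longrightarrow> finite {p. f p \<noteq> \<zero>}"
  unfolding fin_supp_def by auto

lemma FS_carrier: "f \<in> FS \<Longrightarrow> f p \<in> carrier R"
  by (metis FS_D FS_outside D_carrier zero_closed)

lemma FS_zero: "(\<lambda>p. \<zero>) \<in> FS"
  unfolding fin_supp_def using D_zero by auto

lemma FS_single: "p \<in> P \<Longrightarrow> a \<in> D p \<Longrightarrow> single_at R a p \<in> FS"
  unfolding fin_supp_def single_at_def using D_zero by auto

lemma FS_add:
  assumes "f \<in> FS" "g \<in> FS" shows "(\<lambda>p. f p \<oplus> g p) \<in> FS"
proof -
  have "finite ({p. f p \<noteq> \<zero>} \<union> {p. g p \<noteq> \<zero>})" using assms by (auto simp: FS_finite)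
  then have "finite {p. f p \<oplus> g p \<noteq> \<zero>}" by (rule rev_finite_subset) auto
  then show ?thesis using assms D_add unfolding fin_supp_def by auto
qed

lemma FS_neg:
  assumes "f \<in> FS" shows "(\<lambda>p. \<ominus> f p) \<in> FS"
  using assms D_neg finite_subset[of "{p. \<ominus> f p \<noteq> \<zero>}" "{p. f p \<noteq> \<zero>}"]
  unfolding fin_supp_def by (force intro: D_carrier)

lemma FS_restrict:
  assumes "f \<in> FS" shows "(\<lambda>p. if p \<in> T then f p else \<zero>) \<in> FS"
proof -
  have "finite {p. (if p \<in> T then f p else \<zero>) \<noteq> \<zero>}"
    by (rule finite_subset[OF _ FS_finite[OF assms]]) auto
  then show ?thesis using assms D_zero unfolding fin_supp_def by auto
qed

text \<open>One point is peeled off a finite superset of the support at a time. The rule reduces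
  additive and biadditive identities to single terms, which is how almost every fact about
  convolutions and about the summation map is checked.\<close>

lemma FS_induct [consumes 1, case_names zero single add]:
  assumes "f \<in> FS" and zero: "Q (\<lambda>p. \<zero>)"
    and single: "\<And>p a. p \<in> P \<Longrightarrow> a \<in> D p \<Longrightarrow> Q (single_at R a p)"
    and add: "\<And>f g. f \<in> FS \<Longrightarrow> g \<in> FS \<Longrightarrow> Q f \<Longrightarrow> Q g \<Longrightarrow> Q (\<lambda>p. f p \<oplus> g p)"
  shows "Q f"
proof -
  have "f \<in> FS \<Longrightarrow> {p. f p \<noteq> \<zero>} \<subseteq> F \<Longrightarrow> Q f" if "finite F" for F f
    using that
  proof (induction F arbitrary: f)
    case empty
    then have "f = (\<lambda>p. \<zero>)" by auto
    then show ?case using zero by simp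
  next
    case (insert x F)
    show ?case
    proof (cases "x \<in> P")
      case False
      then have "f x = \<zero>" using insert.prems FS_outside by blast
      then have "{p. f p \<noteq> \<zero>} \<subseteq> F" using insert.prems by auto
      then show ?thesis using insert by blast
    next
      case x: True
      define g where "g = (\<lambda>p. if p \<in> - {x} then f p else \<zero>)"
      have g: "g \<in> FS" unfolding g_def by (rule FS_restrict) (rule insert.prems)
      have "{p. g p \<noteq> \<zero>} \<subseteq> F" using insert.prems by (auto simp: g_def)
      then have "Q g" using insert.IH g by blast
      moreover have "f = (\<lambda>p. single_at R (f x) x p \<oplus> g p)"
        using FS_carrier[OF insert.prems(1)] by (auto simp: g_def single_at_def)
      moreover have "f x \<in> D x" using insert.prems x FS_D by blast
      ultimately show ?thesis
        using add[OF FS_single[OF x] g single[OF x]] by metis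
    qed
  qed
  from this[OF FS_finite[OF assms(1)] assms(1)] show ?thesis by auto
qed

lemma abelian_group_FS:
  assumes "carrier M = FS" "zero M = (\<lambda>p. \<zero>)" "add M = (\<lambda>f g p. f p \<oplus> g p)"
  shows "abelian_group M"
proof (rule abelian_groupI)
  show "\<exists>g \<in> carrier M. g \<oplus>\<^bsub>M\<^esub> f = \<zero>\<^bsub>M\<^esub>" if "f \<in> carrier M" for f
    using that FS_neg[of f] FS_carrier[of f] assms by (intro bexI[of _ "\<lambda>p. \<ominus> f p"]) (auto simp: l_neg)
qed (auto simp: assms FS_zero FS_add FS_carrier a_assoc intro!: ext a_comm)

lemma a_minus_FS:
  assumes "carrier M = FS" "zero M = (\<lambda>p. \<zero>)" "add M = (\<lambda>f g p. f p \<oplus> g p)"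
    and f: "f \<in> FS" "g \<in> FS"
  shows "f \<ominus>\<^bsub>M\<^esub> g = (\<lambda>p. f p \<ominus> g p)"
proof -
  interpret M: abelian_group M by (rule abelian_group_FS) fact+
  have "\<ominus>\<^bsub>M\<^esub> g = (\<lambda>p. \<ominus> g p)"
    using assms FS_neg[OF f(2)] by (intro M.minus_equality) (auto simp: l_neg FS_carrier)
  then show ?thesis using assms by (simp add: a_minus_def)
qed

end

text \<open>The product \<open>m\<close> of two coefficients may depend on their indices, as the
  twist by the action does for formal sums.\<close>

locale graded_conv = graded_family R P D
  for R (structure) and P :: "'p set" and D :: "'p \<Rightarrow> 'a set" +
  fixes mul :: "'p \<Rightarrow> 'p \<Rightarrow> 'p" and m :: "'p \<Rightarrow> 'p \<Rightarrow> 'a \<Rightarrow> 'a \<Rightarrow> 'a"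
  assumes mul_closed: "p \<in> P \<Longrightarrow> q \<in> P \<Longrightarrow> mul p q \<in> P"
    and m_closed: "p \<in> P \<Longrightarrow> q \<in> P \<Longrightarrow> a \<in> D p \<Longrightarrow> b \<in> D q \<Longrightarrow> m p q a b \<in> D (mul p q)"
    and m_add_left: "p \<in> P \<Longrightarrow> q \<in> P \<Longrightarrow> a \<in> D p \<Longrightarrow> a' \<in> D p \<Longrightarrow> b \<in> D q \<Longrightarrow>
      m p q (a \<oplus> a') b = m p q a b \<oplus> m p q a' b"
    and m_add_right: "p \<in> P \<Longrightarrow> q \<in> P \<Longrightarrow> a \<in> D p \<Longrightarrow> b \<in> D q \<Longrightarrow> b' \<in> D q \<Longrightarrow>
      m p q a (b \<oplus> b') = m p q a b \<oplus> m p q a b'"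
begin

abbreviation conv_R (infixl "\<star>" 70) where "f \<star> g \<equiv> conv R mul m f g"

lemma m_carrier: "p \<in> P \<Longrightarrow> q \<in> P \<Longrightarrow> a \<in> D p \<Longrightarrow> b \<in> D q \<Longrightarrow> m p q a b \<in> carrier R"
  using m_closed D_carrier mul_closed by blast

lemma m_zero_left: "p \<in> P \<Longrightarrow> q \<in> P \<Longrightarrow> b \<in> D q \<Longrightarrow> m p q \<zero> b = \<zero>"
  using m_add_left[of p q \<zero> \<zero> b] m_carrier[of p q \<zero> b] D_zero[of p] add.l_cancel_one' by fastforce

lemma m_zero_right: "p \<in> P \<Longrightarrow> q \<in> P \<Longrightarrow> a \<in> D p \<Longrightarrow> m p q a \<zero> = \<zero>"
  using m_add_right[of p q a \<zero> \<zero>] m_carrier[of p q a \<zero>] D_zero[of q] add.l_cancel_one' by fastforce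

text \<open>Summing over a rectangle of index pairs makes the additivity of a convolution visible.\<close>

lemma conv_rectangle:
  assumes f: "f \<in> FS" and g: "g \<in> FS" and F: "finite F" "{p. f p \<noteq> \<zero>} \<subseteq> F" "F \<subseteq> P"
    and G: "finite G" "{q. g q \<noteq> \<zero>} \<subseteq> G" "G \<subseteq> P"
  shows "(f \<star> g) r = finsum R (\<lambda>(p, q). if mul p q = r then m p q (f p) (g q) else \<zero>) (F \<times> G)"
  unfolding conv_def
proof (rule add.finprod_mono_neutral_cong_left)
  have mem: "p \<in> P" "f p \<in> D p" if "p \<in> F" for p using that F FS_D[OF f] by auto
  have mem': "q \<in> P" "g q \<in> D q" if "q \<in> G" for q using that G FS_D[OF g] by auto
  show "(case i of (p, q) \<Rightarrow> if mul p q = r then m p q (f p) (g q) else \<zero>) = \<zero>"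
    if i: "i \<in> F \<times> G - {(p, q). f p \<noteq> \<zero> \<and> g q \<noteq> \<zero> \<and> mul p q = r}" for i
  proof (cases i)
    case (Pair p q)
    then have "p \<in> F" "q \<in> G" "f p = \<zero> \<or> g q = \<zero> \<or> mul p q \<noteq> r" using i by auto
    then show ?thesis using Pair mem[of p] mem'[of q] m_zero_left m_zero_right by auto
  qed
  show "(\<lambda>(p, q). if mul p q = r then m p q (f p) (g q) else \<zero>) \<in> F \<times> G \<rightarrow> carrier R"
    using mem mem' by (auto simp: m_carrier)
qed (use F G in auto)

lemma conv_add_left:
  assumes f: "f \<in> FS" "f' \<in> FS" and g: "g \<in> FS"
  shows "(\<lambda>p. f p \<oplus> f' p) \<star> g = (\<lambda>r. (f \<star> g) r \<oplus> (f' \<star> g) r)"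
proof
  fix r
  define F where "F = {p. f p \<noteq> \<zero>} \<union> {p. f' p \<noteq> \<zero>}"
  define G where "G = {p. g p \<noteq> \<zero>}"
  have F: "finite F" "{p. f p \<noteq> \<zero>} \<subseteq> F" "{p. f' p \<noteq> \<zero>} \<subseteq> F" "{p. f p \<oplus> f' p \<noteq> \<zero>} \<subseteq> F" "F \<subseteq> P"
    and G: "finite G" "{p. g p \<noteq> \<zero>} \<subseteq> G" "G \<subseteq> P"
    using f g FS_finite FS_outside unfolding F_def G_def by auto
  have mem: "p \<in> P" "f p \<in> D p" "f' p \<in> D p" if "p \<in> F" for p
    using f F that FS_D by blast+
  have mem': "p \<in> P" "g p \<in> D p" if "p \<in> G" for p
    using g G that FS_D by blast+
  note rect = conv_rectangle[OF _ g F(1) _ F(5) G]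
  have "finsum R (\<lambda>(p, q). if mul p q = r then m p q (f p \<oplus> f' p) (g q) else \<zero>) (F \<times> G) =
     (\<Oplus>x \<in> F \<times> G. (case x of (p, q) \<Rightarrow> if mul p q = r then m p q (f p) (g q) else \<zero>) \<oplus>
       (case x of (p, q) \<Rightarrow> if mul p q = r then m p q (f' p) (g q) else \<zero>))"
    using mem mem' by (intro finsum_cong') (auto simp: m_carrier m_add_left)
  also have "\<dots> = (f \<star> g) r \<oplus> (f' \<star> g) r"
    unfolding rect[OF f(1) F(2)] rect[OF f(2) F(3)]
    using mem mem' by (intro finsum_addf) (auto simp: m_carrier)
  finally show "((\<lambda>p. f p \<oplus> f' p) \<star> g) r = (f \<star> g) r \<oplus> (f' \<star> g) r"
    unfolding rect[OF FS_add[OF f] F(4)] .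
qed

lemma conv_add_right:
  assumes f: "f \<in> FS" and g: "g \<in> FS" "g' \<in> FS"
  shows "f \<star> (\<lambda>p. g p \<oplus> g' p) = (\<lambda>r. (f \<star> g) r \<oplus> (f \<star> g') r)"
proof
  fix r
  define F where "F = {p. f p \<noteq> \<zero>}"
  define G where "G = {p. g p \<noteq> \<zero>} \<union> {p. g' p \<noteq> \<zero>}"
  have G: "finite G" "{p. g p \<noteq> \<zero>} \<subseteq> G" "{p. g' p \<noteq> \<zero>} \<subseteq> G" "{p. g p \<oplus> g' p \<noteq> \<zero>} \<subseteq> G" "G \<subseteq> P"
    and F: "finite F" "{p. f p \<noteq> \<zero>} \<subseteq> F" "F \<subseteq> P"
    using f g FS_finite FS_outside unfolding F_def G_def by auto
  have mem: "p \<in> P" "g p \<in> D p" "g' p \<in> D p" if "p \<in> G" for p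
    using g G that FS_D by blast+
  have mem': "p \<in> P" "f p \<in> D p" if "p \<in> F" for p
    using f F that FS_D by blast+
  note rect = conv_rectangle[OF f _ F G(1) _ G(5)]
  have "finsum R (\<lambda>(p, q). if mul p q = r then m p q (f p) (g q \<oplus> g' q) else \<zero>) (F \<times> G) =
     (\<Oplus>x \<in> F \<times> G. (case x of (p, q) \<Rightarrow> if mul p q = r then m p q (f p) (g q) else \<zero>) \<oplus>
       (case x of (p, q) \<Rightarrow> if mul p q = r then m p q (f p) (g' q) else \<zero>))"
    using mem mem' by (intro finsum_cong') (auto simp: m_carrier m_add_right)
  also have "\<dots> = (f \<star> g) r \<oplus> (f \<star> g') r"
    unfolding rect[OF g(1) G(2)] rect[OF g(2) G(3)]
    using mem mem' by (intro finsum_addf) (auto simp: m_carrier)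
  finally show "(f \<star> (\<lambda>p. g p \<oplus> g' p)) r = (f \<star> g) r \<oplus> (f \<star> g') r"
    unfolding rect[OF FS_add[OF g] G(4)] .
qed

lemma conv_zero_left: "(\<lambda>p. \<zero>) \<star> g = (\<lambda>p. \<zero>)"
  and conv_zero_right: "f \<star> (\<lambda>p. \<zero>) = (\<lambda>p. \<zero>)"
  by (simp_all add: conv_def fun_eq_iff)

lemma conv_single_single:
  assumes "p \<in> P" "q \<in> P" "a \<in> D p" "b \<in> D q"
  shows "single_at R a p \<star> single_at R b q = single_at R (m p q a b) (mul p q)"
proof
  fix r
  have "(single_at R a p \<star> single_at R b q) r =
    finsum R (\<lambda>(p', q'). if mul p' q' = r
      then m p' q' (single_at R a p p') (single_at R b q q') else \<zero>) ({p} \<times> {q})"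
    using assms by (intro conv_rectangle FS_single) (auto simp: single_at_def)
  also have "\<dots> = single_at R (m p q a b) (mul p q) r"
    using assms m_carrier by (auto simp: single_at_def)
  finally show "(single_at R a p \<star> single_at R b q) r = single_at R (m p q a b) (mul p q) r" .
qed

lemma conv_closed: "f \<in> FS \<Longrightarrow> g \<in> FS \<Longrightarrow> f \<star> g \<in> FS"
proof (induction f rule: FS_induct)
  case (single p a)
  show ?case using \<open>g \<in> FS\<close>
    by (induction g rule: FS_induct)
      (use single in \<open>simp_all add: conv_zero_right FS_zero FS_single conv_single_single
        conv_add_right FS_add mul_closed m_closed\<close>)
qed (simp_all add: conv_zero_left FS_zero conv_add_left FS_add)

end


section \<open>Ideals and quotients of unital algebras\<close>

locale unital_algebra = assoc_algebra K A + U: ring A for K (structure) and A (structure)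

lemma (in unital_algebra) alg_ideal_imp_ideal:
  assumes "alg_ideal K A I" shows "ideal I A"
  using assms unfolding alg_ideal_def submodule_def
  by (intro idealI U.ring_axioms) auto

lemma (in assoc_algebra) submodule_Inter:
  assumes "\<And>H. H \<in> \<H> \<Longrightarrow> submodule H K A" "\<H> \<noteq> {}"
  shows "submodule (\<Inter>\<H>) K A"
proof (rule submoduleI)
  show "\<Inter>\<H> \<subseteq> carrier A" using assms submoduleE(1) by blast
  show "\<zero>\<^bsub>A\<^esub> \<in> \<Inter>\<H>" using assms(1) subgroup.one_closed by (fastforce simp: submodule_def)
qed (use assms submoduleE(3,4,5) in blast)+

lemma (in assoc_algebra) alg_ideal_gen:
  assumes "E \<subseteq> carrier A" shows "alg_ideal K A (gen_alg_ideal K A E)" "E \<subseteq> gen_alg_ideal K A E"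
proof -
  have "alg_ideal K A (carrier A)"
    by (simp add: alg_ideal_def carrier_is_submodule alg_m_closed)
  then show "alg_ideal K A (gen_alg_ideal K A E)"
    using assms unfolding alg_ideal_def gen_alg_ideal_def
    by (intro conjI submodule_Inter) auto
qed (auto simp: gen_alg_ideal_def)

lemma gen_alg_ideal_least: "alg_ideal K A I \<Longrightarrow> E \<subseteq> I \<Longrightarrow> gen_alg_ideal K A E \<subseteq> I"
  unfolding gen_alg_ideal_def by blast

lemma (in assoc_algebra) alg_subalgebra_gen:
  assumes "E \<subseteq> carrier A"
  shows "alg_subalgebra K A (gen_alg_subalgebra K A E)" "E \<subseteq> gen_alg_subalgebra K A E"
proof -
  have "alg_subalgebra K A (carrier A)"
    by (simp add: alg_subalgebra_def carrier_is_submodule alg_m_closed)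
  then show "alg_subalgebra K A (gen_alg_subalgebra K A E)"
    using assms unfolding alg_subalgebra_def gen_alg_subalgebra_def
    by (intro conjI submodule_Inter) auto
qed (auto simp: gen_alg_subalgebra_def)

lemma gen_alg_subalgebra_least:
  "alg_subalgebra K A B \<Longrightarrow> E \<subseteq> B \<Longrightarrow> gen_alg_subalgebra K A E \<subseteq> B"
  unfolding gen_alg_subalgebra_def by blast

lemma (in assoc_algebra) alg_subalgebra_imp_assoc_algebra:
  assumes "alg_subalgebra K A B" shows "assoc_algebra K (A\<lparr>carrier := B\<rparr>)"
proof -
  have sub: "submodule B K A" and "\<And>x y. x \<in> B \<Longrightarrow> y \<in> B \<Longrightarrow> x \<otimes>\<^bsub>A\<^esub> y \<in> B"
    using assms unfolding alg_subalgebra_def by auto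
  moreover have "B \<subseteq> carrier A" by (rule submoduleE(1)[OF sub])
  ultimately show ?thesis
    using submodule.submodule_is_module[OF sub module_axioms]
    by (intro assoc_algebra.intro assoc_algebra_axioms.intro)
      (auto simp: K.field_axioms alg_m_assoc alg_l_distr alg_r_distr alg_smult_l alg_smult_r subset_iff)
qed

section \<open>The quotient of a unital algebra by an ideal\<close>

locale algebra_quotient = unital_algebra K A for K (structure) and A (structure) +
  fixes I assumes alg_ideal: "alg_ideal K A I"
begin

sublocale I: ideal I A by (rule alg_ideal_imp_ideal[OF alg_ideal])

abbreviation Q where "Q \<equiv> quot_algebra A I"
abbreviation coset where "coset x \<equiv> I +>\<^bsub>A\<^esub> x"

lemma carrier_Q: "carrier Q = coset ` carrier A"
  unfolding quot_algebra_def FactRing_def A_RCOSETS_def' by auto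

lemma coset_eq_iff:
  assumes "x \<in> carrier A" "y \<in> carrier A"
  shows "coset x = coset y \<longleftrightarrow> x \<ominus>\<^bsub>A\<^esub> y \<in> I"
  using assms I.a_repr_independence' I.a_rcos_self I.a_rcos_module_minus[OF U.ring_axioms] by metis

lemma coset_hom:
  assumes "x \<in> carrier A" "y \<in> carrier A"
  shows "coset x \<oplus>\<^bsub>Q\<^esub> coset y = coset (x \<oplus>\<^bsub>A\<^esub> y)"
    and "coset x \<otimes>\<^bsub>Q\<^esub> coset y = coset (x \<otimes>\<^bsub>A\<^esub> y)"
  using assms by (auto simp: quot_algebra_def FactRing_def I.a_rcos_sum I.rcoset_mult_add)

lemma coset_one: "\<one>\<^bsub>Q\<^esub> = coset \<one>\<^bsub>A\<^esub>"
  by (auto simp: quot_algebra_def FactRing_def)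

lemma zero_Q: "\<zero>\<^bsub>Q\<^esub> = coset \<zero>\<^bsub>A\<^esub>"
  unfolding I.a_rcos_const[OF I.zero_closed] by (simp add: quot_algebra_def FactRing_def)

lemma ring_Q: "ring Q"
proof (intro ringI abelian_groupI monoidI)
  show "\<exists>y \<in> carrier Q. y \<oplus>\<^bsub>Q\<^esub> x = \<zero>\<^bsub>Q\<^esub>" if "x \<in> carrier Q" for x
    using that by (auto simp: carrier_Q coset_hom zero_Q M.l_neg intro!: bexI[of _ "\<ominus>\<^bsub>A\<^esub> _"])
qed (auto simp: carrier_Q coset_hom coset_one zero_Q M.a_ac U.m_assoc U.l_distr U.r_distr)

text \<open>A scalar multiple of a coset is a union over all its representatives, so the point is
  that each of them contributes the same coset.\<close>

lemma coset_smult: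
  assumes c: "c \<in> carrier K" and x: "x \<in> carrier A"
  shows "c \<odot>\<^bsub>Q\<^esub> coset x = coset (c \<odot>\<^bsub>A\<^esub> x)"
proof -
  have "coset (c \<odot>\<^bsub>A\<^esub> y) = coset (c \<odot>\<^bsub>A\<^esub> x)" if "y \<in> coset x" for y
  proof -
    have y: "y \<in> carrier A" using that I.a_elemrcos_carrier x by blast
    have "y \<ominus>\<^bsub>A\<^esub> x \<in> I" using that x y I.a_rcos_module_minus[OF U.ring_axioms] by blast
    then have "c \<odot>\<^bsub>A\<^esub> (y \<ominus>\<^bsub>A\<^esub> x) \<in> I"
      using alg_ideal c by (intro submodule.smult_closed[of _ K]) (auto simp: alg_ideal_def)
    then show ?thesis using c x y
      by (subst coset_eq_iff) (auto simp: a_minus_def smult_r_distr smult_r_minus)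
  qed
  moreover have "x \<in> coset x" by (rule I.a_rcos_self[OF x])
  ultimately have "(\<Union>y \<in> coset x. coset (c \<odot>\<^bsub>A\<^esub> y)) = coset (c \<odot>\<^bsub>A\<^esub> x)" by blast
  then show ?thesis by (simp only: quot_algebra_def module.simps)
qed

sublocale Q: ring Q by (rule ring_Q)

lemma coset_closed: "x \<in> carrier A \<Longrightarrow> coset x \<in> carrier Q"
  by (simp add: carrier_Q)

lemma assoc_algebra_Q: "assoc_algebra K Q"
proof (intro assoc_algebra.intro assoc_algebra_axioms.intro moduleI K.field_axioms Q.abelian_group_axioms)
  show "cring K" by (rule K.is_cring)
qed (auto simp: carrier_Q coset_hom coset_smult smult_l_distr smult_r_distr smult_assoc1
  alg_m_assoc alg_l_distr alg_r_distr alg_smult_l alg_smult_r alg_m_closed)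

lemma unital_algebra_Q: "unital_algebra K Q"
  by (intro unital_algebra.intro assoc_algebra_Q ring_Q)

end

text \<open>Negation is the action of the scalar -1.\<close>

lemma (in module) submoduleI_smult:
  assumes "H \<subseteq> carrier M" "\<zero>\<^bsub>M\<^esub> \<in> H"
    and "\<And>a b. a \<in> H \<Longrightarrow> b \<in> H \<Longrightarrow> a \<oplus>\<^bsub>M\<^esub> b \<in> H"
    and smult: "\<And>c x. c \<in> carrier R \<Longrightarrow> x \<in> H \<Longrightarrow> c \<odot>\<^bsub>M\<^esub> x \<in> H"
  shows "submodule H R M"
proof (rule submoduleI)
  fix a assume "a \<in> H"
  then show "\<ominus>\<^bsub>M\<^esub> a \<in> H"
    using smult[of "\<ominus> \<one>" a] smult_l_minus[of \<one> a] assms(1) by auto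
qed fact+

text \<open>The elements of the generated subalgebra that satisfy \<open>Q\<close> form a subalgebra
  containing the generators.\<close>

lemma (in assoc_algebra) gen_alg_subalgebra_induct [consumes 2, case_names base zero add smult mult]:
  assumes E: "E \<subseteq> carrier A" and a: "a \<in> gen_alg_subalgebra K A E"
    and base: "\<And>x. x \<in> E \<Longrightarrow> Q x" and zero: "Q \<zero>\<^bsub>A\<^esub>"
    and add: "\<And>x y. x \<in> gen_alg_subalgebra K A E \<Longrightarrow> y \<in> gen_alg_subalgebra K A E \<Longrightarrow>
      Q x \<Longrightarrow> Q y \<Longrightarrow> Q (x \<oplus>\<^bsub>A\<^esub> y)"
    and smult: "\<And>c x. c \<in> carrier K \<Longrightarrow> x \<in> gen_alg_subalgebra K A E \<Longrightarrow> Q x \<Longrightarrow> Q (c \<odot>\<^bsub>A\<^esub> x)"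
    and mult: "\<And>x y. x \<in> gen_alg_subalgebra K A E \<Longrightarrow> y \<in> gen_alg_subalgebra K A E \<Longrightarrow>
      Q x \<Longrightarrow> Q y \<Longrightarrow> Q (x \<otimes>\<^bsub>A\<^esub> y)"
  shows "Q a"
proof -
  let ?G = "gen_alg_subalgebra K A E"
  have sub: "submodule ?G K A" and cl: "\<And>x y. x \<in> ?G \<Longrightarrow> y \<in> ?G \<Longrightarrow> x \<otimes>\<^bsub>A\<^esub> y \<in> ?G"
    using alg_subalgebra_gen(1)[OF E] unfolding alg_subalgebra_def by auto
  have "\<zero>\<^bsub>A\<^esub> \<in> ?G" using subgroup.one_closed[of ?G] sub by (fastforce simp: submodule_def)
  then have "submodule {x \<in> ?G. Q x} K A"
    using submoduleE(1,4,5)[OF sub] zero add smult by (intro submoduleI_smult) auto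
  then have "alg_subalgebra K A {x \<in> ?G. Q x}"
    unfolding alg_subalgebra_def using cl mult by auto
  from gen_alg_subalgebra_least[OF this, of E] a alg_subalgebra_gen(2)[OF E] base show ?thesis
    by blast
qed

text \<open>The domain is going to be the algebra of formal sums, for which neither associativity
  nor a unit has been established. The cosets of the kernel are the fibres of \<open>h\<close>, and
  each operation of the quotient, a union over representatives, can be evaluated on fibres
  directly.\<close>

lemma quot_algebra_kernel_iso:
  fixes L :: "('k, 'a, 'm) module_scheme" and B :: "('k, 'b, 'n) module_scheme"
  assumes "abelian_group L" "abelian_group B"
    and closed: "\<And>x y. x \<in> carrier L \<Longrightarrow> y \<in> carrier L \<Longrightarrow> x \<otimes>\<^bsub>L\<^esub> y \<in> carrier L"
      "\<And>c x. c \<in> carrier K \<Longrightarrow> x \<in> carrier L \<Longrightarrow> c \<odot>\<^bsub>L\<^esub> x \<in> carrier L"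
    and onto: "h ` carrier L = carrier B"
    and h_add: "\<And>x y. x \<in> carrier L \<Longrightarrow> y \<in> carrier L \<Longrightarrow> h (x \<oplus>\<^bsub>L\<^esub> y) = h x \<oplus>\<^bsub>B\<^esub> h y"
    and h_mult: "\<And>x y. x \<in> carrier L \<Longrightarrow> y \<in> carrier L \<Longrightarrow> h (x \<otimes>\<^bsub>L\<^esub> y) = h x \<otimes>\<^bsub>B\<^esub> h y"
    and h_smult: "\<And>c x. c \<in> carrier K \<Longrightarrow> x \<in> carrier L \<Longrightarrow> h (c \<odot>\<^bsub>L\<^esub> x) = c \<odot>\<^bsub>B\<^esub> h x"
    and I: "I = {x \<in> carrier L. h x = \<zero>\<^bsub>B\<^esub>}"
  shows "f \<in> carrier L \<Longrightarrow> the_elem (h ` (I +>\<^bsub>L\<^esub> f)) = h f"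
    and "(\<lambda>C. the_elem (h ` C)) \<in> alg_iso K (quot_algebra L I) B"
proof -
  interpret L: abelian_group L by fact
  interpret B: abelian_group B by fact
  define fib where "fib b = {x \<in> carrier L. h x = b}" for b
  have h_closed: "h x \<in> carrier B" if "x \<in> carrier L" for x using onto that by auto
  have h_diff: "h (x \<ominus>\<^bsub>L\<^esub> y) \<oplus>\<^bsub>B\<^esub> h y = h x" if "x \<in> carrier L" "y \<in> carrier L" for x y
    using h_add[of "x \<ominus>\<^bsub>L\<^esub> y" y] that by (simp add: a_minus_def L.a_assoc L.l_neg)
  have diff: "(x \<ominus>\<^bsub>L\<^esub> y) \<oplus>\<^bsub>L\<^esub> y = x" if "x \<in> carrier L" "y \<in> carrier L" for x y
    using that by (simp add: a_minus_def L.a_assoc L.l_neg)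
  have coset: "I +>\<^bsub>L\<^esub> f = fib (h f)" if f: "f \<in> carrier L" for f
  proof (intro equalityI subsetI)
    fix x assume "x \<in> fib (h f)"
    then have x: "x \<in> carrier L" "h x = h f" by (auto simp: fib_def)
    then have "h (x \<ominus>\<^bsub>L\<^esub> f) = \<zero>\<^bsub>B\<^esub>"
      using h_diff[OF x(1) f] h_closed[OF f] h_closed[OF L.minus_closed[OF x(1) f]] by simp
    then show "x \<in> I +>\<^bsub>L\<^esub> f"
      unfolding a_r_coset_def' I using x f diff[OF x(1) f]
      by (intro UN_I[of "x \<ominus>\<^bsub>L\<^esub> f"]) simp_all
  qed (use f h_closed in \<open>auto simp: a_r_coset_def' I fib_def h_add\<close>)
  have val: "the_elem (h ` fib (h f)) = h f" if "f \<in> carrier L" for f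
  proof -
    have "h ` fib (h f) = {h f}" using that by (auto simp: fib_def)
    then show ?thesis by simp
  qed
  then show "f \<in> carrier L \<Longrightarrow> the_elem (h ` (I +>\<^bsub>L\<^esub> f)) = h f" by (simp add: coset)
  have carr: "carrier (quot_algebra L I) = (\<lambda>f. fib (h f)) ` carrier L"
    by (auto simp: quot_algebra_def FactRing_def A_RCOSETS_def' coset)
  have q_add: "fib (h f) \<oplus>\<^bsub>quot_algebra L I\<^esub> fib (h g) = fib (h (f \<oplus>\<^bsub>L\<^esub> g))"
    if "f \<in> carrier L" "g \<in> carrier L" for f g
  proof -
    \<comment> \<open>An element x of the fibre over the sum is split as (x - g) + g.\<close>
    have "x \<in> set_add L (fib (h f)) (fib (h g))" if x: "x \<in> fib (h (f \<oplus>\<^bsub>L\<^esub> g))" for x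
    proof -
      have x: "x \<in> carrier L" "h x = h f \<oplus>\<^bsub>B\<^esub> h g"
        using x h_add \<open>f \<in> carrier L\<close> \<open>g \<in> carrier L\<close> by (auto simp: fib_def)
      have "h (x \<ominus>\<^bsub>L\<^esub> g) = h f"
        using h_diff[OF x(1) \<open>g \<in> carrier L\<close>] x(2) that
          h_closed[OF \<open>f \<in> carrier L\<close>] h_closed[OF \<open>g \<in> carrier L\<close>] h_closed[OF L.minus_closed[OF x(1) \<open>g \<in> carrier L\<close>]]
        by simp
      then show ?thesis
        unfolding set_add_def' fib_def using x diff[OF x(1) \<open>g \<in> carrier L\<close>] \<open>g \<in> carrier L\<close>
        by (intro UN_I[of "x \<ominus>\<^bsub>L\<^esub> g"] UN_I[of g]) simp_all
    qed
    then have "set_add L (fib (h f)) (fib (h g)) = fib (h (f \<oplus>\<^bsub>L\<^esub> g))"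
      using that by (auto simp: set_add_def' fib_def h_add)
    then show ?thesis by (simp add: quot_algebra_def FactRing_def)
  qed
  have self: "f \<in> fib (h f)" if "f \<in> carrier L" for f using that by (simp add: fib_def)
  have q_mult: "fib (h f) \<otimes>\<^bsub>quot_algebra L I\<^esub> fib (h g) = fib (h (f \<otimes>\<^bsub>L\<^esub> g))"
    if "f \<in> carrier L" "g \<in> carrier L" for f g
  proof -
    have "I +>\<^bsub>L\<^esub> (x \<otimes>\<^bsub>L\<^esub> y) = fib (h (f \<otimes>\<^bsub>L\<^esub> g))" if "x \<in> fib (h f)" "y \<in> fib (h g)" for x y
      using that \<open>f \<in> carrier L\<close> \<open>g \<in> carrier L\<close> by (auto simp: coset closed h_mult fib_def)
    then have "(\<Union>x \<in> fib (h f). \<Union>y \<in> fib (h g). I +>\<^bsub>L\<^esub> (x \<otimes>\<^bsub>L\<^esub> y)) = fib (h (f \<otimes>\<^bsub>L\<^esub> g))"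
      using self that by blast
    then show ?thesis by (simp add: quot_algebra_def FactRing_def rcoset_mult_def)
  qed
  have q_smult: "c \<odot>\<^bsub>quot_algebra L I\<^esub> fib (h f) = fib (h (c \<odot>\<^bsub>L\<^esub> f))"
    if "c \<in> carrier K" "f \<in> carrier L" for c f
  proof -
    have "I +>\<^bsub>L\<^esub> (c \<odot>\<^bsub>L\<^esub> x) = fib (h (c \<odot>\<^bsub>L\<^esub> f))" if "x \<in> fib (h f)" for x
      using that \<open>c \<in> carrier K\<close> \<open>f \<in> carrier L\<close> by (auto simp: coset closed h_smult fib_def)
    then have "(\<Union>x \<in> fib (h f). I +>\<^bsub>L\<^esub> (c \<odot>\<^bsub>L\<^esub> x)) = fib (h (c \<odot>\<^bsub>L\<^esub> f))"
      using self that by blast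
    then show ?thesis by (simp only: quot_algebra_def module.simps)
  qed
  have "bij_betw (\<lambda>C. the_elem (h ` C)) (carrier (quot_algebra L I)) (carrier B)"
    unfolding bij_betw_def carr
  proof
    show "inj_on (\<lambda>C. the_elem (h ` C)) ((\<lambda>f. fib (h f)) ` carrier L)"
      by (auto intro!: inj_onI simp: val)
    show "(\<lambda>C. the_elem (h ` C)) ` (\<lambda>f. fib (h f)) ` carrier L = carrier B"
      using onto by (force simp: val image_image cong: image_cong)
  qed
  then show "(\<lambda>C. the_elem (h ` C)) \<in> alg_iso K (quot_algebra L I) B"
    unfolding alg_iso_def by (auto simp: carr q_add q_mult q_smult val closed simp flip: h_add h_mult h_smult)
qed


section \<open>Semigroup algebras\<close>

locale monoid_algebra = K?: field K + P: monoid P for K (structure) and P (structure)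
begin

abbreviation KP where "KP \<equiv> semigroup_algebra K P"

abbreviation conv_K (infixl "\<star>" 70) where
  "f \<star> g \<equiv> conv K (mult P) (\<lambda>p q a b. a \<otimes>\<^bsub>K\<^esub> b) f g"

sublocale graded_conv K "carrier P" "\<lambda>p. carrier K" "mult P" "\<lambda>p q a b. a \<otimes>\<^bsub>K\<^esub> b"
  by unfold_locales (auto simp: K.l_distr K.r_distr)

lemma KP_sel:
  "carrier KP = FS"
  "mult KP = conv K (mult P) (\<lambda>p q a b. a \<otimes>\<^bsub>K\<^esub> b)"
  "zero KP = (\<lambda>p. \<zero>\<^bsub>K\<^esub>)" "add KP = (\<lambda>f g p. f p \<oplus>\<^bsub>K\<^esub> g p)"
  "one KP = single_at K \<one>\<^bsub>K\<^esub> \<one>\<^bsub>P\<^esub>" "smult KP = (\<lambda>c f p. c \<otimes>\<^bsub>K\<^esub> f p)"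
  by (simp_all add: semigroup_algebra_def fin_supp_def conv_def fun_eq_iff)

lemma smult_FS: "c \<in> carrier K \<Longrightarrow> f \<in> FS \<Longrightarrow> (\<lambda>p. c \<otimes>\<^bsub>K\<^esub> f p) \<in> FS"
  using finite_subset[of "{p. c \<otimes>\<^bsub>K\<^esub> f p \<noteq> \<zero>\<^bsub>K\<^esub>}" "{p. f p \<noteq> \<zero>\<^bsub>K\<^esub>}"]
  unfolding fin_supp_def by force

lemma smult_single: "c \<in> carrier K \<Longrightarrow> (\<lambda>q. c \<otimes>\<^bsub>K\<^esub> single_at K a p q) = single_at K (c \<otimes>\<^bsub>K\<^esub> a) p"
  by (auto simp: single_at_def)

lemma smult_add: "c \<in> carrier K \<Longrightarrow> f \<in> FS \<Longrightarrow> g \<in> FS \<Longrightarrow>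
    (\<lambda>p. c \<otimes>\<^bsub>K\<^esub> (f p \<oplus>\<^bsub>K\<^esub> g p)) = (\<lambda>p. c \<otimes>\<^bsub>K\<^esub> f p \<oplus>\<^bsub>K\<^esub> c \<otimes>\<^bsub>K\<^esub> g p)"
  by (simp add: K.r_distr FS_carrier)

lemmas conv_simps = conv_zero_left conv_zero_right conv_add_left conv_add_right conv_single_single
  conv_closed FS_zero FS_add FS_single

text \<open>All three arguments reduce by additivity to single terms, where the claim is
  associativity in \<open>P\<close> and in \<open>K\<close>.\<close>

lemma conv_assoc:
  assumes "f \<in> FS" "g \<in> FS" "h \<in> FS"
  shows "f \<star> g \<star> h = f \<star> (g \<star> h)"
  using assms(1)
proof (induction f rule: FS_induct)
  case (single p a)
  show ?case using assms(2)
  proof (induction g rule: FS_induct)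
    case (single q b)
    show ?case using assms(3)
      by (induction h rule: FS_induct)
        (use \<open>p \<in> carrier P\<close> \<open>a \<in> carrier K\<close> single in
          \<open>simp_all add: conv_simps P.m_assoc K.m_assoc\<close>)
  qed (use single assms in \<open>simp_all add: conv_simps\<close>)
qed (use assms in \<open>simp_all add: conv_simps\<close>)

lemma conv_one:
  assumes "f \<in> FS"
  shows "single_at K \<one>\<^bsub>K\<^esub> \<one>\<^bsub>P\<^esub> \<star> f = f" "f \<star> single_at K \<one>\<^bsub>K\<^esub> \<one>\<^bsub>P\<^esub> = f"
  using assms by (induction f rule: FS_induct) (simp_all add: conv_simps)

lemma conv_smult:
  assumes c: "c \<in> carrier K" and "f \<in> FS" "g \<in> FS"
  shows "(\<lambda>p. c \<otimes>\<^bsub>K\<^esub> f p) \<star> g = (\<lambda>r. c \<otimes>\<^bsub>K\<^esub> (f \<star> g) r)"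
    and "f \<star> (\<lambda>p. c \<otimes>\<^bsub>K\<^esub> g p) = (\<lambda>r. c \<otimes>\<^bsub>K\<^esub> (f \<star> g) r)"
proof -
  have "(\<lambda>p. c \<otimes>\<^bsub>K\<^esub> f p) \<star> g = (\<lambda>r. c \<otimes>\<^bsub>K\<^esub> (f \<star> g) r) \<and>
    f \<star> (\<lambda>p. c \<otimes>\<^bsub>K\<^esub> g p) = (\<lambda>r. c \<otimes>\<^bsub>K\<^esub> (f \<star> g) r)"
    using \<open>f \<in> FS\<close>
  proof (induction f rule: FS_induct)
    case (single p a)
    show ?case using \<open>g \<in> FS\<close>
      by (induction g rule: FS_induct)
        (use c single in \<open>simp_all add: conv_simps smult_single smult_add smult_FS K.m_ac\<close>)
  qed (use c \<open>g \<in> FS\<close> in \<open>simp_all add: conv_simps smult_add smult_FS\<close>)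
  then show "(\<lambda>p. c \<otimes>\<^bsub>K\<^esub> f p) \<star> g = (\<lambda>r. c \<otimes>\<^bsub>K\<^esub> (f \<star> g) r)"
    "f \<star> (\<lambda>p. c \<otimes>\<^bsub>K\<^esub> g p) = (\<lambda>r. c \<otimes>\<^bsub>K\<^esub> (f \<star> g) r)" by auto
qed

lemma unital_algebra_KP: "unital_algebra K KP"
proof (intro unital_algebra.intro assoc_algebra.intro assoc_algebra_axioms.intro moduleI ringI)
  show "abelian_group KP" by (rule abelian_group_FS) (simp_all add: KP_sel)
  then show "abelian_group KP" .
  show "cring K" by (rule K.is_cring)
  show "Group.monoid KP"
    by (rule monoidI) (simp_all add: KP_sel conv_simps conv_assoc conv_one)
qed (auto simp: K.field_axioms KP_sel conv_simps conv_assoc conv_smult smult_FS smult_add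
  FS_carrier K.l_distr K.m_assoc)

end


section \<open>Partial representations that are constant along the natural order\<close>

text \<open>These are the properties of the canonical map into the quotient by \<open>J\<close> from
  which the partial action and the summation map are built. The unit condition is a separate
  assumption because the identities defining a partial representation do not mention the unit of the
  algebra.\<close>

locale collapsed_rep = S?: inverse_monoid S + B?: unital_algebra K B
  for S :: "('s, 'n) monoid_scheme" (structure)
    and K :: "('k, 'm) ring_scheme" (structure)
    and B :: "('k, 'b, 'q) module_scheme" (structure) +
  fixes \<pi> :: "'s \<Rightarrow> 'b"
  assumes rep: "partial_rep S B \<pi>"
    and rep_one: "\<pi> \<one> = \<one>\<^bsub>B\<^esub>"
    and rep_nat_le: "s \<in> carrier S \<Longrightarrow> t \<in> carrier S \<Longrightarrow> nat_le S s t \<Longrightarrow> \<pi> s = \<pi> t"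
begin

abbreviation mult_B (infixl "\<cdot>" 70) where "x \<cdot> y \<equiv> x \<otimes>\<^bsub>B\<^esub> y"

abbreviation eps ("\<epsilon>") where "\<epsilon> \<equiv> rep_eps S B \<pi>"
abbreviation alg where "alg \<equiv> rep_alg K S B \<pi>"
abbreviation A where "A \<equiv> gen_alg_subalgebra K B (\<epsilon> ` carrier S)"
abbreviation X where "X \<equiv> rep_dom K S B \<pi>"
abbreviation \<alpha> where "\<alpha> \<equiv> rep_act S B \<pi>"

lemma rep_closed [simp, intro]: "s \<in> carrier S \<Longrightarrow> \<pi> s \<in> carrier B"
  using rep unfolding partial_rep_def by auto

lemma rep_left: "s \<in> carrier S \<Longrightarrow> t \<in> carrier S \<Longrightarrow> \<pi> (s\<^sup>\<star>) \<cdot> \<pi> s \<cdot> \<pi> t = \<pi> (s\<^sup>\<star>) \<cdot> \<pi> (s \<otimes> t)"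
  and rep_right: "s \<in> carrier S \<Longrightarrow> t \<in> carrier S \<Longrightarrow> \<pi> s \<cdot> \<pi> t \<cdot> \<pi> (t\<^sup>\<star>) = \<pi> (s \<otimes> t) \<cdot> \<pi> (t\<^sup>\<star>)"
  and rep_regular: "s \<in> carrier S \<Longrightarrow> \<pi> s \<cdot> \<pi> (s\<^sup>\<star>) \<cdot> \<pi> s = \<pi> s"
  using rep unfolding partial_rep_def by auto

lemma eps_closed [simp, intro]: "s \<in> carrier S \<Longrightarrow> \<epsilon> s \<in> carrier B"
  by (simp add: rep_eps_def)

lemma eps_rep: "s \<in> carrier S \<Longrightarrow> \<epsilon> s \<cdot> \<pi> s = \<pi> s"
  by (simp add: rep_eps_def rep_regular)

lemma rep_eps_star: "s \<in> carrier S \<Longrightarrow> \<pi> s \<cdot> \<epsilon> (s\<^sup>\<star>) = \<pi> s"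
  using rep_regular by (simp add: rep_eps_def B.U.m_assoc)

lemma eps_idem: "s \<in> carrier S \<Longrightarrow> \<epsilon> s \<cdot> \<epsilon> s = \<epsilon> s"
  using eps_rep[of s] by (simp add: rep_eps_def flip: B.U.m_assoc)

lemma eps_one: "\<epsilon> \<one> = \<one>\<^bsub>B\<^esub>"
  by (simp add: rep_eps_def rep_one)

text \<open>Inversion preserves the order, since
  \<open>(t \<otimes> e)\<^sup>\<star> = e \<otimes> t\<^sup>\<star>\<close> and an idempotent on
  the left may be moved to the right; so both factors of \<epsilon>_s are constant along it.\<close>

lemma eps_nat_le:
  assumes "s \<in> carrier S" "t \<in> carrier S" "nat_le S s t" shows "\<epsilon> s = \<epsilon> t"
proof -
  obtain e where e: "e \<in> carrier S" "e \<otimes> e = e" "s = t \<otimes> e" using assms(3) by (elim nat_leE)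
  then have "s\<^sup>\<star> = e \<otimes> t\<^sup>\<star>" using assms by (simp add: star_mult star_idem)
  then have "\<pi> (s\<^sup>\<star>) = \<pi> (t\<^sup>\<star>)" using e assms nat_le_idem_mult by (intro rep_nat_le) auto
  then show ?thesis using rep_nat_le[OF assms] by (simp add: rep_eps_def)
qed

text \<open>The element \<open>(s \<otimes> t)\<^sup>\<star> \<otimes> s = t\<^sup>\<star> \<otimes>
  s\<^sup>\<star> \<otimes> s\<close> lies below \<open>t\<^sup>\<star>\<close>, so \<pi> does not
  distinguish the two. This lets the right relation for s and t meet the left relation for
  \<open>(s \<otimes> t)\<^sup>\<star>\<close> and s.\<close>

lemma rep_eps_commute:
  assumes [simp]: "s \<in> carrier S" "t \<in> carrier S"
  shows "\<pi> s \<cdot> \<epsilon> t = \<epsilon> (s \<otimes> t) \<cdot> \<pi> s"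
proof -
  have "\<pi> s \<cdot> \<epsilon> t = \<pi> (s \<otimes> t) \<cdot> \<pi> (t\<^sup>\<star>)"
    using rep_right[of s t] by (simp add: rep_eps_def B.U.m_assoc)
  also have "\<pi> (t\<^sup>\<star>) = \<pi> ((s \<otimes> t)\<^sup>\<star> \<otimes> s)"
    using nat_le_mult_idem[OF _ star_mult_self_idem(2), of s "t\<^sup>\<star>"]
    by (intro rep_nat_le[symmetric]) (simp_all add: star_mult S.m_assoc)
  also have "\<pi> (s \<otimes> t) \<cdot> \<pi> ((s \<otimes> t)\<^sup>\<star> \<otimes> s) = \<epsilon> (s \<otimes> t) \<cdot> \<pi> s"
    using rep_left[of "(s \<otimes> t)\<^sup>\<star>" s] by (simp add: rep_eps_def)
  finally show ?thesis .
qed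

text \<open>Moving \<epsilon>_t across \<open>\<pi> (s\<^sup>\<star>)\<close> and then across
  \<open>\<pi> s\<close> changes its index into
  \<open>s \<otimes> s\<^sup>\<star> \<otimes> t\<close>, which lies below t and so gives
  \<epsilon>_t again.\<close>

lemma eps_commute:
  assumes [simp]: "s \<in> carrier S" "t \<in> carrier S"
  shows "\<epsilon> s \<cdot> \<epsilon> t = \<epsilon> t \<cdot> \<epsilon> s"
proof -
  have "\<epsilon> s \<cdot> \<epsilon> t = \<pi> s \<cdot> (\<pi> (s\<^sup>\<star>) \<cdot> \<epsilon> t)" by (simp add: rep_eps_def B.U.m_assoc)
  also have "\<dots> = \<pi> s \<cdot> (\<epsilon> (s\<^sup>\<star> \<otimes> t) \<cdot> \<pi> (s\<^sup>\<star>))" by (simp add: rep_eps_commute)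
  also have "\<dots> = (\<pi> s \<cdot> \<epsilon> (s\<^sup>\<star> \<otimes> t)) \<cdot> \<pi> (s\<^sup>\<star>)" by (simp add: B.U.m_assoc)
  also have "\<dots> = \<epsilon> (s \<otimes> s\<^sup>\<star> \<otimes> t) \<cdot> \<epsilon> s"
    unfolding rep_eps_commute[of s "s\<^sup>\<star> \<otimes> t", simplified]
    by (simp add: S.m_assoc B.U.m_assoc rep_eps_def)
  also have "\<epsilon> (s \<otimes> s\<^sup>\<star> \<otimes> t) = \<epsilon> t"
    by (intro eps_nat_le nat_le_idem_mult) (auto simp: star_mult_self_idem)
  finally show ?thesis .
qed

lemma eps_image: "\<epsilon> ` carrier S \<subseteq> carrier B" by auto

section \<open>The algebra generated by the idempotents of the representation\<close>

lemma A_submodule: "submodule A K B"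
  and A_mult: "a \<in> A \<Longrightarrow> b \<in> A \<Longrightarrow> a \<cdot> b \<in> A"
  using B.alg_subalgebra_gen(1)[OF eps_image] unfolding alg_subalgebra_def by auto

lemma A_carrier [simp]: "a \<in> A \<Longrightarrow> a \<in> carrier B"
  and A_add: "a \<in> A \<Longrightarrow> b \<in> A \<Longrightarrow> a \<oplus>\<^bsub>B\<^esub> b \<in> A"
  and A_smult: "c \<in> carrier K \<Longrightarrow> a \<in> A \<Longrightarrow> c \<odot>\<^bsub>B\<^esub> a \<in> A"
  using submoduleE(1,4,5)[OF A_submodule] by auto

lemma A_eps: "s \<in> carrier S \<Longrightarrow> \<epsilon> s \<in> A"
  using B.alg_subalgebra_gen(2)[OF eps_image] by auto

lemma A_one: "\<one>\<^bsub>B\<^esub> \<in> A"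
  using A_eps[of \<one>] eps_one by simp

lemma A_zero: "\<zero>\<^bsub>B\<^esub> \<in> A"
  using A_smult[of "\<zero>\<^bsub>K\<^esub>" "\<one>\<^bsub>B\<^esub>"] A_one by simp

lemmas A_induct = B.gen_alg_subalgebra_induct[OF eps_image, consumes 1, case_names base zero add smult mult]

text \<open>Commutation passes from the generators to arbitrary elements in one argument at a time.
  It is what makes the right ideals \<epsilon>_s\<open>A\<close> two-sided.\<close>

lemma A_commute:
  assumes "a \<in> A" "b \<in> A" shows "a \<cdot> b = b \<cdot> a"
proof -
  have eps: "a \<cdot> \<epsilon> s = \<epsilon> s \<cdot> a" if [simp]: "s \<in> carrier S" for s
    using assms(1)
  proof (induction a rule: A_induct)
    case (base x)
    then show ?case by (auto simp: eps_commute)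
  next
    case (mult x y)
    have "x \<cdot> y \<cdot> \<epsilon> s = x \<cdot> (\<epsilon> s \<cdot> y)" using mult by (simp add: B.U.m_assoc)
    also have "\<dots> = \<epsilon> s \<cdot> (x \<cdot> y)" using mult by (simp flip: B.U.m_assoc)
    finally show ?case .
  qed (simp_all add: B.U.l_distr B.U.r_distr B.alg_smult_l B.alg_smult_r)
  show ?thesis using assms(2)
  proof (induction b rule: A_induct)
    case (base x)
    then show ?case using eps by auto
  next
    case (mult x y)
    have "a \<cdot> (x \<cdot> y) = x \<cdot> a \<cdot> y" using mult assms(1) by (simp flip: B.U.m_assoc)
    also have "\<dots> = x \<cdot> y \<cdot> a" using mult assms(1) by (simp add: B.U.m_assoc)
    finally show ?case .
  qed (use assms(1) in \<open>simp_all add: B.U.l_distr B.U.r_distr B.alg_smult_l B.alg_smult_r\<close>)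
qed

text \<open>Multiplied by \<open>\<pi> (s\<^sup>\<star>)\<close> on the right, the equation reads
  \<open>\<alpha> s a = a' \<cdot> \<epsilon> s\<close>, which shows that conjugation does not lead
  out of \<open>A\<close>. A product is treated by carrying \<open>\<pi> s\<close> across one factor
  after the other.\<close>

lemma rep_A_shift:
  assumes "a \<in> A" and [simp]: "s \<in> carrier S"
  shows "\<exists>a' \<in> A. \<pi> s \<cdot> a = a' \<cdot> \<pi> s"
  using assms(1)
proof (induction a rule: A_induct)
  case (base x)
  then show ?case using rep_eps_commute A_eps by auto
next
  case zero
  then show ?case using A_zero by (intro bexI[of _ "\<zero>\<^bsub>B\<^esub>"]) auto
next
  case (add x y)
  then obtain x' y' where "x' \<in> A" "y' \<in> A" "\<pi> s \<cdot> x = x' \<cdot> \<pi> s" "\<pi> s \<cdot> y = y' \<cdot> \<pi> s" by blast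
  then show ?case using add
    by (intro bexI[of _ "x' \<oplus>\<^bsub>B\<^esub> y'"]) (auto simp: B.U.l_distr B.U.r_distr A_add)
next
  case (smult c x)
  then obtain x' where "x' \<in> A" "\<pi> s \<cdot> x = x' \<cdot> \<pi> s" by blast
  then show ?case using smult
    by (intro bexI[of _ "c \<odot>\<^bsub>B\<^esub> x'"]) (auto simp: B.alg_smult_l B.alg_smult_r A_smult)
next
  case (mult x y)
  then obtain x' y' where x': "x' \<in> A" "y' \<in> A" "\<pi> s \<cdot> x = x' \<cdot> \<pi> s" "\<pi> s \<cdot> y = y' \<cdot> \<pi> s" by blast
  have "\<pi> s \<cdot> (x \<cdot> y) = x' \<cdot> \<pi> s \<cdot> y" using mult x' by (simp flip: B.U.m_assoc)
  also have "\<dots> = x' \<cdot> y' \<cdot> \<pi> s" using mult x' by (simp add: B.U.m_assoc)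
  finally show ?case using x' A_mult by blast
qed

text \<open>The ideal generated by an idempotent consists of the elements that it fixes. In this
  form membership is an equation, and all closure properties of the domains become
  calculations.\<close>

lemma X_iff: "s \<in> carrier S \<Longrightarrow> a \<in> X s \<longleftrightarrow> a \<in> A \<and> \<epsilon> s \<cdot> a = a"
proof -
  assume [simp]: "s \<in> carrier S"
  have "\<epsilon> s \<cdot> (\<epsilon> s \<cdot> a) = \<epsilon> s \<cdot> a" if "a \<in> A" for a
    using that eps_idem by (simp flip: B.U.m_assoc)
  then show ?thesis
    unfolding rep_dom_def rep_alg_def by (auto simp: A_mult A_eps) metis
qed

lemma X_A: "s \<in> carrier S \<Longrightarrow> a \<in> X s \<Longrightarrow> a \<in> A"
  by (simp add: X_iff)

lemma X_eps_left: "s \<in> carrier S \<Longrightarrow> a \<in> X s \<Longrightarrow> \<epsilon> s \<cdot> a = a"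
  by (simp add: X_iff)

lemma X_eps_right: "s \<in> carrier S \<Longrightarrow> a \<in> X s \<Longrightarrow> a \<cdot> \<epsilon> s = a"
  by (metis X_iff A_commute A_eps)

lemma X_nat_le: "s \<in> carrier S \<Longrightarrow> t \<in> carrier S \<Longrightarrow> nat_le S s t \<Longrightarrow> X s = X t"
  using X_iff eps_nat_le by auto

section \<open>The partial action by conjugation\<close>

lemma act_A:
  assumes "a \<in> A" and [simp]: "s \<in> carrier S"
  shows "\<alpha> s a \<in> X s"
proof -
  obtain a' where a': "a' \<in> A" "\<pi> s \<cdot> a = a' \<cdot> \<pi> s" using rep_A_shift[OF assms] by blast
  then have "\<alpha> s a = a' \<cdot> \<epsilon> s" by (simp add: rep_act_def rep_eps_def B.U.m_assoc)
  then have "\<alpha> s a \<in> A" using a' by (simp add: A_mult A_eps)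
  moreover have "\<epsilon> s \<cdot> \<alpha> s a = \<alpha> s a"
    using assms eps_rep by (simp add: rep_act_def flip: B.U.m_assoc)
  ultimately show ?thesis by (simp add: X_iff)
qed

lemma act_act:
  assumes [simp]: "s \<in> carrier S" and x: "x \<in> X s"
  shows "\<alpha> s (\<alpha> (s\<^sup>\<star>) x) = x"
proof -
  have [simp]: "x \<in> carrier B" using X_A[OF _ x] by simp
  have "\<alpha> s (\<alpha> (s\<^sup>\<star>) x) = \<epsilon> s \<cdot> x \<cdot> \<epsilon> s" by (simp add: rep_act_def rep_eps_def B.U.m_assoc)
  then show ?thesis using x by (simp add: X_eps_left X_eps_right)
qed

text \<open>Between the two conjugates stands \<open>\<pi> (s\<^sup>\<star>) \<cdot> \<pi> s =
  \<epsilon> (s\<^sup>\<star>)\<close>, which y absorbs.\<close>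

lemma act_mult:
  assumes [simp]: "s \<in> carrier S" and x: "x \<in> A" and y: "y \<in> X (s\<^sup>\<star>)"
  shows "\<alpha> s (x \<cdot> y) = \<alpha> s x \<cdot> \<alpha> s y"
proof -
  have [simp]: "x \<in> carrier B" "y \<in> carrier B" using x X_A[OF _ y] by auto
  have "\<alpha> s x \<cdot> \<alpha> s y = \<pi> s \<cdot> x \<cdot> (\<epsilon> (s\<^sup>\<star>) \<cdot> y) \<cdot> \<pi> (s\<^sup>\<star>)"
    by (simp add: rep_act_def rep_eps_def B.U.m_assoc)
  also have "\<epsilon> (s\<^sup>\<star>) \<cdot> y = y" using y by (simp add: X_eps_left)
  finally show ?thesis by (simp add: rep_act_def B.U.m_assoc)
qed

lemma act_add:
  "s \<in> carrier S \<Longrightarrow> x \<in> carrier B \<Longrightarrow> y \<in> carrier B \<Longrightarrow> \<alpha> s (x \<oplus>\<^bsub>B\<^esub> y) = \<alpha> s x \<oplus>\<^bsub>B\<^esub> \<alpha> s y"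
  by (simp add: rep_act_def B.U.l_distr B.U.r_distr)

lemma act_smult:
  "s \<in> carrier S \<Longrightarrow> c \<in> carrier K \<Longrightarrow> x \<in> carrier B \<Longrightarrow> \<alpha> s (c \<odot>\<^bsub>B\<^esub> x) = c \<odot>\<^bsub>B\<^esub> \<alpha> s x"
  by (simp add: rep_act_def B.alg_smult_l B.alg_smult_r)

lemma act_Int:
  assumes [simp]: "s \<in> carrier S" "t \<in> carrier S" and x: "x \<in> A" "x \<in> X t"
  shows "\<alpha> s x \<in> X (s \<otimes> t)"
proof -
  have [simp]: "x \<in> carrier B" using x by simp
  have "\<epsilon> (s \<otimes> t) \<cdot> \<alpha> s x = \<pi> s \<cdot> (\<epsilon> t \<cdot> x) \<cdot> \<pi> (s\<^sup>\<star>)"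
    using rep_eps_commute[of s t] by (simp add: rep_act_def flip: B.U.m_assoc)
  also have "\<epsilon> t \<cdot> x = x" using x by (simp add: X_eps_left)
  finally have "\<epsilon> (s \<otimes> t) \<cdot> \<alpha> s x = \<alpha> s x" by (simp only: rep_act_def)
  moreover have "\<alpha> s x \<in> A" using X_A[OF _ act_A[OF x(1)]] by simp
  ultimately show ?thesis by (simp add: X_iff)
qed

lemma alg_sel:
  "carrier alg = A" "mult alg = mult B" "add alg = add B" "zero alg = zero B" "one alg = one B"
  "smult alg = smult B"
  by (simp_all add: rep_alg_def)

lemma assoc_algebra_alg: "assoc_algebra K alg"
  unfolding rep_alg_def
  by (rule B.alg_subalgebra_imp_assoc_algebra[OF B.alg_subalgebra_gen(1)[OF eps_image]])

lemma X_zero: "s \<in> carrier S \<Longrightarrow> \<zero>\<^bsub>B\<^esub> \<in> X s"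
  and X_add: "s \<in> carrier S \<Longrightarrow> a \<in> X s \<Longrightarrow> b \<in> X s \<Longrightarrow> a \<oplus>\<^bsub>B\<^esub> b \<in> X s"
  and X_smult: "s \<in> carrier S \<Longrightarrow> c \<in> carrier K \<Longrightarrow> a \<in> X s \<Longrightarrow> c \<odot>\<^bsub>B\<^esub> a \<in> X s"
  by (auto simp: X_iff A_zero A_add A_smult B.U.r_distr B.alg_smult_r)

lemma X_mult:
  assumes "s \<in> carrier S" "a \<in> A" "b \<in> X s" shows "b \<cdot> a \<in> X s" "a \<cdot> b \<in> X s"
proof -
  show "b \<cdot> a \<in> X s" using assms by (auto simp: X_iff A_mult simp flip: B.U.m_assoc)
  then show "a \<cdot> b \<in> X s" using A_commute[of a b] assms X_A by simp
qed

lemma alg_ideal_X: "s \<in> carrier S \<Longrightarrow> alg_ideal K alg (X s)"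
proof -
  assume s: "s \<in> carrier S"
  interpret alg: assoc_algebra K alg by (rule assoc_algebra_alg)
  show ?thesis unfolding alg_ideal_def
    using s by (intro conjI alg.submoduleI_smult)
      (auto simp: alg_sel X_A X_zero X_add X_smult X_mult)
qed

lemma act_bij:
  assumes [simp]: "s \<in> carrier S" shows "bij_betw (\<alpha> s) (X (s\<^sup>\<star>)) (X s)"
proof (rule bij_betw_byWitness[of _ "\<alpha> (s\<^sup>\<star>)"])
  show "\<forall>x \<in> X (s\<^sup>\<star>). \<alpha> (s\<^sup>\<star>) (\<alpha> s x) = x" using act_act[of "s\<^sup>\<star>"] by simp
  show "\<forall>x \<in> X s. \<alpha> s (\<alpha> (s\<^sup>\<star>) x) = x" using act_act[of s] by simp
  show "\<alpha> s ` X (s\<^sup>\<star>) \<subseteq> X s" by (intro image_subsetI act_A X_A[of "s\<^sup>\<star>"]) simp_all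
  show "\<alpha> (s\<^sup>\<star>) ` X s \<subseteq> X (s\<^sup>\<star>)" by (intro image_subsetI act_A X_A[of s]) simp_all
qed

text \<open>On both sides x can be padded with \<open>\<epsilon> (t\<^sup>\<star>) = \<pi>
  (t\<^sup>\<star>) \<cdot> \<pi> t\<close>. The padding supplies the extra factors that the right
  relation needs to merge \<open>\<pi> s \<cdot> \<pi> t\<close> and the left relation needs to
  merge their starred counterparts.\<close>

lemma act_comp:
  assumes [simp]: "s \<in> carrier S" "t \<in> carrier S" and x: "x \<in> X (t\<^sup>\<star>)"
  shows "\<alpha> s (\<alpha> t x) = \<alpha> (s \<otimes> t) x"
proof -
  have [simp]: "x \<in> carrier B" using X_A[OF _ x] by simp
  have e: "\<epsilon> (t\<^sup>\<star>) \<cdot> x \<cdot> \<epsilon> (t\<^sup>\<star>) = x" using x by (simp add: X_eps_left X_eps_right)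
  have l: "\<pi> s \<cdot> \<pi> t \<cdot> \<epsilon> (t\<^sup>\<star>) = \<pi> (s \<otimes> t) \<cdot> \<epsilon> (t\<^sup>\<star>)"
    using rep_right[of s t] by (simp add: rep_eps_def flip: B.U.m_assoc)
  have r: "\<epsilon> (t\<^sup>\<star>) \<cdot> \<pi> (t\<^sup>\<star>) \<cdot> \<pi> (s\<^sup>\<star>) = \<epsilon> (t\<^sup>\<star>) \<cdot> \<pi> (t\<^sup>\<star> \<otimes> s\<^sup>\<star>)"
    using rep_left[of "t\<^sup>\<star>" "s\<^sup>\<star>"] by (simp add: rep_eps_def B.U.m_assoc)
  have "\<alpha> s (\<alpha> t x) = \<pi> s \<cdot> \<pi> t \<cdot> (\<epsilon> (t\<^sup>\<star>) \<cdot> x \<cdot> \<epsilon> (t\<^sup>\<star>)) \<cdot> \<pi> (t\<^sup>\<star>) \<cdot> \<pi> (s\<^sup>\<star>)"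
    unfolding e by (simp add: rep_act_def B.U.m_assoc)
  also have "\<dots> = (\<pi> s \<cdot> \<pi> t \<cdot> \<epsilon> (t\<^sup>\<star>)) \<cdot> x \<cdot> (\<epsilon> (t\<^sup>\<star>) \<cdot> \<pi> (t\<^sup>\<star>) \<cdot> \<pi> (s\<^sup>\<star>))"
    by (simp add: B.U.m_assoc)
  also have "\<dots> = \<pi> (s \<otimes> t) \<cdot> (\<epsilon> (t\<^sup>\<star>) \<cdot> x \<cdot> \<epsilon> (t\<^sup>\<star>)) \<cdot> \<pi> (t\<^sup>\<star> \<otimes> s\<^sup>\<star>)"
    unfolding l r by (simp add: B.U.m_assoc)
  also have "\<dots> = \<alpha> (s \<otimes> t) x" unfolding e by (simp add: rep_act_def star_mult)
  finally show ?thesis .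
qed

lemma partial_action_rep: "partial_action K S alg X \<alpha>"
proof (intro partial_action.intro partial_action_axioms.intro)
  show "inverse_monoid S" by (rule S.inverse_monoid_axioms)
  show "assoc_algebra K alg" by (rule assoc_algebra_alg)
next
  fix s assume [simp]: "s \<in> carrier S"
  show "alg_ideal K alg (X s)" by (simp add: alg_ideal_X)
  show "\<alpha> s \<in> alg_iso K (alg\<lparr>carrier := X (s\<^sup>\<star>)\<rparr>) (alg\<lparr>carrier := X s\<rparr>)"
    unfolding alg_iso_def
    using act_bij[of s] X_A[of "s\<^sup>\<star>"]
    by (auto simp: alg_sel act_mult act_add act_smult)
next
  fix s x assume [simp]: "s \<in> carrier S" and x: "x \<in> X s"
  show "inv_into (X (s\<^sup>\<star>)) (\<alpha> s) x = \<alpha> (s\<^sup>\<star>) x"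
    using act_bij[of s] act_act[of s x] act_A[of x "s\<^sup>\<star>"] X_A[of s x] x
    by (intro inv_into_f_eq) (auto simp: bij_betw_def)
next
  fix s t assume [simp]: "s \<in> carrier S" "t \<in> carrier S"
  show "\<alpha> s ` (X (s\<^sup>\<star>) \<inter> X t) = X s \<inter> X (s \<otimes> t)"
  proof (intro equalityI subsetI)
    fix y assume "y \<in> \<alpha> s ` (X (s\<^sup>\<star>) \<inter> X t)"
    then show "y \<in> X s \<inter> X (s \<otimes> t)" using act_A[of _ s] act_Int[of s t] X_A[of t] by auto
  next
    fix y assume y: "y \<in> X s \<inter> X (s \<otimes> t)"
    then have [simp]: "y \<in> A" using X_A[of s] by simp
    \<comment> \<open>The preimage of y is sought as its image under the inverse map, which lies in
      the ideal of this index. The index is below t, so the ideal is that of t.\<close>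
    have "X (s\<^sup>\<star> \<otimes> (s \<otimes> t)) = X t"
      using nat_le_idem_mult[of "s\<^sup>\<star> \<otimes> s" t] star_mult_self_idem(2)[of s]
      by (intro X_nat_le) (auto simp: S.m_assoc)
    then have "\<alpha> (s\<^sup>\<star>) y \<in> X (s\<^sup>\<star>) \<inter> X t"
      using act_A[of y "s\<^sup>\<star>"] act_Int[of "s\<^sup>\<star>" "s \<otimes> t" y] y by simp
    then show "y \<in> \<alpha> s ` (X (s\<^sup>\<star>) \<inter> X t)"
      using act_act[of s y] y by (metis IntD1 \<open>s \<in> carrier S\<close> imageI)
  qed
next
  fix s t x assume "s \<in> carrier S" "t \<in> carrier S" "x \<in> X (t\<^sup>\<star>) \<inter> X (t\<^sup>\<star> \<otimes> s\<^sup>\<star>)"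
  then show "\<alpha> s (\<alpha> t x) = \<alpha> (s \<otimes> t) x" by (intro act_comp) auto
qed

end


section \<open>The crossed product of the induced partial action\<close>

context collapsed_rep
begin

section \<open>The module of formal sums and its convolution\<close>

abbreviation L where "L \<equiv> formal_sums S alg X \<alpha>"
abbreviation FS where "FS \<equiv> fin_supp B (carrier S) X"
abbreviation \<Phi> where "\<Phi> \<equiv> rep_sum B \<pi>"

lemma graded_conv_alg:
  "graded_conv alg (carrier S) X (mult S) (\<lambda>s t a b. \<alpha> s (\<alpha> (s\<^sup>\<star>) a \<cdot> b))"
proof -
  interpret alg: assoc_algebra K alg by (rule assoc_algebra_alg)
  have X_neg: "\<ominus>\<^bsub>alg\<^esub> a \<in> X s" if "s \<in> carrier S" "a \<in> X s" for s a
    using alg.submoduleE(3)[of "X s"] alg_ideal_X[of s] that unfolding alg_ideal_def by blast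
  show ?thesis
  proof (unfold_locales, goal_cases)
    \<comment> \<open>Cases 6 to 8 are closure and the two additivity laws of the twisted product.
      For closure, the inner product lies in the ideal of index t, which \<open>\<alpha> s\<close>
      maps into that of index \<open>s \<otimes> t\<close>.\<close>
    case (6 s t a b)
    have "\<alpha> (s\<^sup>\<star>) a \<in> X (s\<^sup>\<star>)" using 6 by (intro act_A X_A[of s]) auto
    then have "\<alpha> (s\<^sup>\<star>) a \<cdot> b \<in> A" "\<alpha> (s\<^sup>\<star>) a \<cdot> b \<in> X t"
      using X_mult[of t "\<alpha> (s\<^sup>\<star>) a" b] 6 X_A[of "s\<^sup>\<star>"] X_A[of t] by auto
    then show ?case using 6 by (intro act_Int) auto
  next
    case (7 s t a a' b)
    have "\<alpha> (s\<^sup>\<star>) a \<in> carrier B" "\<alpha> (s\<^sup>\<star>) a' \<in> carrier B" "b \<in> carrier B" "a \<in> carrier B" "a' \<in> carrier B"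
      using 7 act_A[of _ "s\<^sup>\<star>"] X_A[of s] X_A[of t] X_A[of "s\<^sup>\<star>"] by auto
    then show ?case using 7 by (simp add: alg_sel act_add B.U.l_distr)
  next
    case (8 s t a b b')
    have "\<alpha> (s\<^sup>\<star>) a \<in> carrier B" "b \<in> carrier B" "b' \<in> carrier B"
      using 8 act_A[of _ "s\<^sup>\<star>"] X_A[of s] X_A[of t] X_A[of "s\<^sup>\<star>"] by auto
    then show ?case using 8 by (simp add: alg_sel act_add B.U.r_distr)
  qed (auto simp: alg_sel X_zero X_add X_neg intro: X_A)
qed

lemma single_alg: "single_at alg = single_at B"
  by (intro ext) (simp add: single_at_def alg_sel)

lemma fin_supp_alg: "fin_supp alg = fin_supp B"
  by (intro ext) (simp add: fin_supp_def alg_sel)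

text \<open>The rewrites express addition and zero of the subalgebra through those of
  \<open>B\<close>. Negation and finite sums refer to the carrier by definition and therefore stay
  in \<open>alg\<close>.\<close>

sublocale L: graded_conv alg "carrier S" X "mult S" "\<lambda>s t a b. \<alpha> s (\<alpha> (s\<^sup>\<star>) a \<cdot> b)"
  rewrites "carrier alg = A" and "add alg = add B" and "zero alg = zero B"
    and "single_at alg = single_at B" and "fin_supp alg = fin_supp B"
  by (rule graded_conv_alg) (simp_all only: alg_sel single_alg fin_supp_alg)

lemma L_sel:
  "carrier L = FS"
  "mult L = conv alg (mult S) (\<lambda>s t a b. \<alpha> s (\<alpha> (s\<^sup>\<star>) a \<cdot> b))"
  "zero L = (\<lambda>s. \<zero>\<^bsub>B\<^esub>)" "add L = (\<lambda>f g s. f s \<oplus>\<^bsub>B\<^esub> g s)"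
  "smult L = (\<lambda>c f s. c \<odot>\<^bsub>B\<^esub> f s)"
  by (simp_all add: formal_sums_def fin_supp_def conv_def fun_eq_iff alg_sel)

lemma FS_B: "f \<in> FS \<Longrightarrow> f s \<in> carrier B"
  using L.FS_carrier by simp

lemma module_L: "module K L"
proof (rule moduleI)
  show "abelian_group L" by (rule L.abelian_group_FS) (simp_all add: L_sel)
  show "c \<odot>\<^bsub>L\<^esub> f \<in> carrier L" if "c \<in> carrier K" "f \<in> carrier L" for c f
    using that finite_subset[of "{s. c \<odot>\<^bsub>B\<^esub> f s \<noteq> \<zero>\<^bsub>B\<^esub>}" "{s. f s \<noteq> \<zero>\<^bsub>B\<^esub>}"] X_smult
    by (force simp: L_sel fin_supp_def)
qed (auto simp: B.K.is_cring L_sel FS_B smult_l_distr smult_r_distr smult_assoc1)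

sublocale L_mod: module K L by (rule module_L)

section \<open>The summation map\<close>

lemma rep_sum_superset:
  assumes f: "f \<in> FS" and F: "finite F" "{s. f s \<noteq> \<zero>\<^bsub>B\<^esub>} \<subseteq> F" "F \<subseteq> carrier S"
  shows "\<Phi> f = (\<Oplus>\<^bsub>B\<^esub>s \<in> F. f s \<cdot> \<pi> s)"
  unfolding rep_sum_def using F FS_B[OF f]
  by (intro M.add.finprod_mono_neutral_cong_left) auto

lemma rep_sum_closed: "f \<in> FS \<Longrightarrow> \<Phi> f \<in> carrier B"
  unfolding rep_sum_def by (intro M.finsum_closed Pi_I B.U.m_closed rep_closed)
    (use FS_B L.FS_outside in blast)+

lemma rep_sum_zero: "\<Phi> (\<lambda>s. \<zero>\<^bsub>B\<^esub>) = \<zero>\<^bsub>B\<^esub>"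
  by (simp add: rep_sum_def)

lemma rep_sum_single:
  assumes "s \<in> carrier S" "a \<in> X s" shows "\<Phi> (single_at B a s) = a \<cdot> \<pi> s"
proof -
  have "\<Phi> (single_at B a s) = (\<Oplus>\<^bsub>B\<^esub>s' \<in> {s}. single_at B a s s' \<cdot> \<pi> s')"
    using assms by (intro rep_sum_superset L.FS_single) (auto simp: single_at_def)
  moreover have "a \<in> carrier B" using X_A assms by simp
  ultimately show ?thesis using assms by (simp add: single_at_def)
qed

lemma rep_sum_add:
  assumes f: "f \<in> FS" and g: "g \<in> FS"
  shows "\<Phi> (\<lambda>s. f s \<oplus>\<^bsub>B\<^esub> g s) = \<Phi> f \<oplus>\<^bsub>B\<^esub> \<Phi> g"
proof -
  define F where "F = {s. f s \<noteq> \<zero>\<^bsub>B\<^esub>} \<union> {s. g s \<noteq> \<zero>\<^bsub>B\<^esub>}"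
  have F: "finite F" "{s. f s \<noteq> \<zero>\<^bsub>B\<^esub>} \<subseteq> F" "{s. g s \<noteq> \<zero>\<^bsub>B\<^esub>} \<subseteq> F"
    "{s. f s \<oplus>\<^bsub>B\<^esub> g s \<noteq> \<zero>\<^bsub>B\<^esub>} \<subseteq> F" "F \<subseteq> carrier S"
    using L.FS_finite[OF f] L.FS_finite[OF g] L.FS_outside[OF f] L.FS_outside[OF g]
    unfolding F_def by auto
  have closed: "\<pi> s \<in> carrier B" if "s \<in> F" for s using that F by blast
  have "(\<Oplus>\<^bsub>B\<^esub>s \<in> F. (f s \<oplus>\<^bsub>B\<^esub> g s) \<cdot> \<pi> s) = (\<Oplus>\<^bsub>B\<^esub>s \<in> F. f s \<cdot> \<pi> s \<oplus>\<^bsub>B\<^esub> g s \<cdot> \<pi> s)"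
    using closed FS_B[OF f] FS_B[OF g] by (intro M.finsum_cong') (auto simp: B.U.l_distr)
  also have "\<dots> = (\<Oplus>\<^bsub>B\<^esub>s \<in> F. f s \<cdot> \<pi> s) \<oplus>\<^bsub>B\<^esub> (\<Oplus>\<^bsub>B\<^esub>s \<in> F. g s \<cdot> \<pi> s)"
    using closed FS_B[OF f] FS_B[OF g] by (intro M.finsum_addf) auto
  finally show ?thesis
    using rep_sum_superset[OF f F(1,2,5)] rep_sum_superset[OF g F(1,3,5)]
      rep_sum_superset[OF L.FS_add[OF f g] F(1,4,5)] by simp
qed

lemma rep_sum_smult:
  assumes c: "c \<in> carrier K" and "f \<in> FS"
  shows "\<Phi> (\<lambda>s. c \<odot>\<^bsub>B\<^esub> f s) = c \<odot>\<^bsub>B\<^esub> \<Phi> f"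
  using assms(2)
proof (induction f rule: L.FS_induct)
  case zero
  then show ?case using c by (simp add: rep_sum_zero)
next
  case (single s a)
  have "(\<lambda>t. c \<odot>\<^bsub>B\<^esub> single_at B a s t) = single_at B (c \<odot>\<^bsub>B\<^esub> a) s"
    using c by (auto simp: single_at_def)
  moreover have "a \<in> carrier B" using X_A single by simp
  ultimately show ?case using c single by (simp add: rep_sum_single X_smult B.alg_smult_l)
next
  case (add f g)
  have "(\<lambda>s. c \<odot>\<^bsub>B\<^esub> (f s \<oplus>\<^bsub>B\<^esub> g s)) = (\<lambda>s. c \<odot>\<^bsub>B\<^esub> f s \<oplus>\<^bsub>B\<^esub> c \<odot>\<^bsub>B\<^esub> g s)"
    using c add by (simp add: FS_B smult_r_distr)
  moreover have "(\<lambda>s. c \<odot>\<^bsub>B\<^esub> f s) \<in> FS" "(\<lambda>s. c \<odot>\<^bsub>B\<^esub> g s) \<in> FS"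
    using L_mod.smult_closed[OF c] add by (auto simp: L_sel)
  ultimately show ?case using c add by (simp add: rep_sum_add rep_sum_closed smult_r_distr)
qed

text \<open>The inner and outer conjugations meet in \<epsilon>_s, which a absorbs. The left
  relation rewrites \<open>\<pi> (s\<^sup>\<star>) \<cdot> \<pi> (s \<otimes> t)\<close> as
  \<open>\<epsilon> (s\<^sup>\<star>) \<cdot> \<pi> t\<close>; this idempotent commutes with b and
  is absorbed by \<open>\<pi> s\<close>.\<close>

lemma rep_sum_conv_single:
  assumes [simp]: "s \<in> carrier S" "t \<in> carrier S" and a: "a \<in> X s" and b: "b \<in> X t"
  shows "\<alpha> s (\<alpha> (s\<^sup>\<star>) a \<cdot> b) \<cdot> \<pi> (s \<otimes> t) = a \<cdot> \<pi> s \<cdot> (b \<cdot> \<pi> t)"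
proof -
  have [simp]: "a \<in> carrier B" "b \<in> carrier B" using X_A[OF _ a] X_A[OF _ b] by auto
  have c: "b \<cdot> \<epsilon> (s\<^sup>\<star>) = \<epsilon> (s\<^sup>\<star>) \<cdot> b" using X_A[OF _ b] by (intro A_commute A_eps) auto
  have "\<alpha> s (\<alpha> (s\<^sup>\<star>) a \<cdot> b) \<cdot> \<pi> (s \<otimes> t) = (\<epsilon> s \<cdot> a) \<cdot> \<pi> s \<cdot> b \<cdot> (\<pi> (s\<^sup>\<star>) \<cdot> \<pi> (s \<otimes> t))"
    by (simp add: rep_act_def rep_eps_def B.U.m_assoc)
  also have "\<epsilon> s \<cdot> a = a" using a by (simp add: X_eps_left)
  also have "\<pi> (s\<^sup>\<star>) \<cdot> \<pi> (s \<otimes> t) = \<epsilon> (s\<^sup>\<star>) \<cdot> \<pi> t"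
    using rep_left[of s t] by (simp add: rep_eps_def)
  also have "a \<cdot> \<pi> s \<cdot> b \<cdot> (\<epsilon> (s\<^sup>\<star>) \<cdot> \<pi> t) = a \<cdot> \<pi> s \<cdot> (b \<cdot> \<epsilon> (s\<^sup>\<star>)) \<cdot> \<pi> t"
    by (simp add: B.U.m_assoc)
  also have "\<dots> = a \<cdot> (\<pi> s \<cdot> \<epsilon> (s\<^sup>\<star>)) \<cdot> (b \<cdot> \<pi> t)"
    unfolding c by (simp add: B.U.m_assoc)
  finally show ?thesis by (simp add: rep_eps_star)
qed

lemma rep_sum_mult:
  assumes "f \<in> FS" "g \<in> FS" shows "\<Phi> (f \<otimes>\<^bsub>L\<^esub> g) = \<Phi> f \<cdot> \<Phi> g"
  unfolding L_sel using assms(1)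
proof (induction f rule: L.FS_induct)
  case zero
  then show ?case using assms(2)
    by (simp add: L.conv_zero_left rep_sum_zero rep_sum_closed)
next
  case (single s a)
  show ?case using assms(2)
  proof (induction g rule: L.FS_induct)
    case zero
    then show ?case using single
      by (simp add: L.conv_zero_right rep_sum_zero rep_sum_closed L.FS_single)
  next
    case (single t b)
    then show ?case using \<open>s \<in> carrier S\<close> \<open>a \<in> X s\<close>
      by (simp add: L.conv_single_single L.m_closed rep_sum_single rep_sum_conv_single)
  next
    case (add g h)
    then show ?case using single
      by (simp add: L.conv_add_right L.FS_single L.conv_closed rep_sum_add rep_sum_closed B.U.r_distr)
  qed
next
  case (add f h)
  then show ?case using assms(2)
    by (simp add: L.conv_add_left L.conv_closed rep_sum_add rep_sum_closed B.U.l_distr)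
qed

text \<open>For a in \<open>X s\<close>, inserting \<open>\<epsilon> (s\<^sup>\<star>)\<close> after
  \<open>\<pi> s\<close> lets the left relation turn the product into
  \<open>a \<cdot> \<pi> (s \<otimes> t)\<close>. The coefficient a need not be admissible at the
  new index, but multiplying it by \<epsilon> of that index makes it so without changing the
  product.\<close>

lemma rep_sum_image_mult:
  assumes [simp]: "t \<in> carrier S" and "f \<in> FS"
  shows "\<exists>g \<in> FS. \<Phi> g = \<Phi> f \<cdot> \<pi> t"
  using assms(2)
proof (induction f rule: L.FS_induct)
  case zero
  then show ?case using L.FS_zero by (intro bexI[of _ "\<lambda>s. \<zero>\<^bsub>B\<^esub>"]) (auto simp: rep_sum_zero)
next
  case (single s a)
  have [simp]: "s \<in> carrier S" "a \<in> A" "a \<in> carrier B" using single X_A[of s a] by auto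
  have e: "a \<cdot> \<epsilon> (s \<otimes> t) \<in> X (s \<otimes> t)"
    using A_commute[of a "\<epsilon> (s \<otimes> t)"]
    by (simp add: X_iff A_mult A_eps eps_idem flip: B.U.m_assoc)
  have "a \<cdot> \<pi> s \<cdot> \<pi> t = a \<cdot> (\<pi> s \<cdot> \<epsilon> (s\<^sup>\<star>)) \<cdot> \<pi> t" by (simp add: rep_eps_star)
  also have "\<dots> = a \<cdot> \<pi> s \<cdot> (\<pi> (s\<^sup>\<star>) \<cdot> \<pi> s \<cdot> \<pi> t)" by (simp add: rep_eps_def B.U.m_assoc)
  also have "\<dots> = a \<cdot> \<epsilon> s \<cdot> \<pi> (s \<otimes> t)" unfolding rep_left[of s t, simplified] by (simp add: rep_eps_def B.U.m_assoc)
  also have "a \<cdot> \<epsilon> s = a" using single by (simp add: X_eps_right)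
  also have "a \<cdot> \<pi> (s \<otimes> t) = a \<cdot> \<epsilon> (s \<otimes> t) \<cdot> \<pi> (s \<otimes> t)"
    using eps_rep[of "s \<otimes> t"] by (simp add: B.U.m_assoc)
  finally show ?case
    using e single by (intro bexI[of _ "single_at B (a \<cdot> \<epsilon> (s \<otimes> t)) (s \<otimes> t)"])
      (auto simp: rep_sum_single L.FS_single)
next
  case (add f h)
  then obtain f' h' where "f' \<in> FS" "h' \<in> FS" "\<Phi> f' = \<Phi> f \<cdot> \<pi> t" "\<Phi> h' = \<Phi> h \<cdot> \<pi> t" by blast
  then show ?case using add
    by (intro bexI[of _ "\<lambda>s. f' s \<oplus>\<^bsub>B\<^esub> h' s"]) (auto simp: rep_sum_add rep_sum_closed L.FS_add B.U.l_distr)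
qed

lemma submodule_rep_sum_image: "submodule (\<Phi> ` FS) K B"
proof (rule submoduleI_smult)
  show "\<Phi> ` FS \<subseteq> carrier B" using rep_sum_closed by auto
  show "\<zero>\<^bsub>B\<^esub> \<in> \<Phi> ` FS" using rep_sum_zero L.FS_zero by (metis imageI)
  show "a \<oplus>\<^bsub>B\<^esub> b \<in> \<Phi> ` FS" if "a \<in> \<Phi> ` FS" "b \<in> \<Phi> ` FS" for a b
    using that L.FS_add by (auto simp flip: rep_sum_add)
  show "c \<odot>\<^bsub>B\<^esub> a \<in> \<Phi> ` FS" if "c \<in> carrier K" "a \<in> \<Phi> ` FS" for c a
    using that L_mod.smult_closed[of c] by (auto simp: L_sel simp flip: rep_sum_smult)
qed

section \<open>The relations lie in the kernel of the summation map\<close>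

abbreviation rels where
  "rels \<equiv> {single_at alg a r \<ominus>\<^bsub>L\<^esub> single_at alg a t | a r t.
     r \<in> carrier S \<and> t \<in> carrier S \<and> nat_le S r t \<and> a \<in> X r}"

abbreviation ker where "ker \<equiv> {f \<in> FS. \<Phi> f = \<zero>\<^bsub>B\<^esub>}"

lemma rep_sum_minus:
  assumes "f \<in> FS" "g \<in> FS" shows "\<Phi> f = \<Phi> (f \<ominus>\<^bsub>L\<^esub> g) \<oplus>\<^bsub>B\<^esub> \<Phi> g"
proof -
  have "f = (f \<ominus>\<^bsub>L\<^esub> g) \<oplus>\<^bsub>L\<^esub> g" and "f \<ominus>\<^bsub>L\<^esub> g \<in> FS"
    using assms L_mod.M.minus_closed[of f g]
    by (simp_all add: a_minus_def L_mod.M.a_assoc L_mod.M.l_neg flip: L_sel(1))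
  then show ?thesis using rep_sum_add[of "f \<ominus>\<^bsub>L\<^esub> g" g] assms(2) by (simp add: L_sel)
qed

lemma alg_ideal_ker: "alg_ideal K L ker"
  unfolding alg_ideal_def
proof (intro conjI L_mod.submoduleI_smult ballI)
  fix c f assume "c \<in> carrier K" "f \<in> ker"
  then show "c \<odot>\<^bsub>L\<^esub> f \<in> ker"
    using L_mod.smult_closed[of c f] by (auto simp: L_sel rep_sum_smult)
next
  fix f g assume "f \<in> carrier L" "g \<in> ker"
  then show "f \<otimes>\<^bsub>L\<^esub> g \<in> ker" "g \<otimes>\<^bsub>L\<^esub> f \<in> ker"
    using rep_sum_mult[of f g] rep_sum_mult[of g f] L.conv_closed rep_sum_closed
    by (auto simp: L_sel)
qed (auto simp: L_sel L.FS_zero L.FS_add rep_sum_zero rep_sum_add)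

lemma rels_ker: "rels \<subseteq> ker"
proof
  fix f assume "f \<in> rels"
  then obtain a r t where f: "f = single_at B a r \<ominus>\<^bsub>L\<^esub> single_at B a t"
    and rt: "r \<in> carrier S" "t \<in> carrier S" "nat_le S r t" "a \<in> X r" by (auto simp: single_alg)
  have "a \<in> X t" "\<pi> r = \<pi> t" using X_nat_le rep_nat_le rt by auto
  then have FS: "single_at B a r \<in> FS" "single_at B a t \<in> FS"
    and "\<Phi> (single_at B a r) = \<Phi> (single_at B a t)"
    using rt by (auto simp: L.FS_single rep_sum_single)
  moreover have "f \<in> FS" using L_mod.M.minus_closed FS unfolding f L_sel by blast
  ultimately show "f \<in> ker"
    using rep_sum_minus[OF FS] rep_sum_closed[of "single_at B a t"] rep_sum_closed[of f]
    by (simp flip: f)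
qed

end

text \<open>The maps \<open>proj T\<close> are the projections of the grading of \<open>B\<close> by the maximal group image of
  \<open>S\<close>, the saturated sets \<open>T\<close> standing for sets of group elements.\<close>

locale graded_rep = collapsed_rep S K B \<pi>
  for S :: "('s, 'n) monoid_scheme" (structure)
    and K :: "('k, 'm) ring_scheme" (structure)
    and B :: "('k, 'b, 'q) module_scheme" (structure) and \<pi> +
  fixes proj :: "'s set \<Rightarrow> 'b \<Rightarrow> 'b"
  assumes proj_closed: "saturated T \<Longrightarrow> b \<in> carrier B \<Longrightarrow> proj T b \<in> carrier B"
    and proj_add: "saturated T \<Longrightarrow> b \<in> carrier B \<Longrightarrow> c \<in> carrier B \<Longrightarrow>
      proj T (b \<oplus>\<^bsub>B\<^esub> c) = proj T b \<oplus>\<^bsub>B\<^esub> proj T c"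
    and proj_smult: "saturated T \<Longrightarrow> k \<in> carrier K \<Longrightarrow> b \<in> carrier B \<Longrightarrow>
      proj T (k \<odot>\<^bsub>B\<^esub> b) = k \<odot>\<^bsub>B\<^esub> proj T b"
    and proj_one: "saturated T \<Longrightarrow> proj T \<one>\<^bsub>B\<^esub> = (if \<one> \<in> T then \<one>\<^bsub>B\<^esub> else \<zero>\<^bsub>B\<^esub>)"
    and proj_rep: "saturated T \<Longrightarrow> b \<in> carrier B \<Longrightarrow> s \<in> carrier S \<Longrightarrow>
      proj T (b \<cdot> \<pi> s) = proj {u \<in> carrier S. u \<otimes> s \<in> T} b \<cdot> \<pi> s"
    and generated: "submodule M K B \<Longrightarrow> \<one>\<^bsub>B\<^esub> \<in> M \<Longrightarrow>
      (\<And>b s. b \<in> M \<Longrightarrow> s \<in> carrier S \<Longrightarrow> b \<cdot> \<pi> s \<in> M) \<Longrightarrow> carrier B \<subseteq> M"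
begin

section \<open>Homogeneous components and the determination of the kernel\<close>

lemma proj_zero: "saturated T \<Longrightarrow> proj T \<zero>\<^bsub>B\<^esub> = \<zero>\<^bsub>B\<^esub>"
  using proj_smult[of T "\<zero>\<^bsub>K\<^esub>" "\<zero>\<^bsub>B\<^esub>"] proj_closed[of T "\<zero>\<^bsub>B\<^esub>"] by simp

text \<open>For a generator \<open>\<pi> s \<cdot> \<pi> (s\<^sup>\<star>)\<close> the two shifts
  combine to the condition \<open>u \<otimes> s \<otimes> s\<^sup>\<star> \<in> T\<close>; this
  element lies below u, so saturation gives back T. Generalizing b allows a product in
  \<open>A\<close> to be split off one factor at a time.\<close>

lemma proj_A:
  assumes "a \<in> A" "saturated T" "b \<in> carrier B"
  shows "proj T (b \<cdot> a) = proj T b \<cdot> a"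
  using assms
proof (induction a arbitrary: b rule: A_induct)
  case (base x)
  then obtain s where [simp]: "s \<in> carrier S" and x: "x = \<pi> s \<cdot> \<pi> (s\<^sup>\<star>)"
    by (auto simp: rep_eps_def)
  define U where "U = {u \<in> carrier S. u \<otimes> s\<^sup>\<star> \<in> T}"
  have U: "saturated U" unfolding U_def using base by (intro saturated_right_quot) auto
  have T: "{u \<in> carrier S. u \<otimes> s \<in> U} = T"
  proof -
    have "u \<otimes> s \<otimes> s\<^sup>\<star> \<in> T \<longleftrightarrow> u \<in> T" if "u \<in> carrier S" for u
      using that nat_le_mult_idem[OF _ star_mult_self_idem(1), of s u]
      by (intro saturatedD[OF \<open>saturated T\<close>]) (auto simp: S.m_assoc)
    moreover have "T \<subseteq> carrier S" using \<open>saturated T\<close> by (simp add: saturated_def)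
    ultimately show ?thesis unfolding U_def by auto
  qed
  have "proj T (b \<cdot> \<pi> s \<cdot> \<pi> (s\<^sup>\<star>)) = proj U (b \<cdot> \<pi> s) \<cdot> \<pi> (s\<^sup>\<star>)"
    unfolding U_def using base by (intro proj_rep) auto
  also have "proj U (b \<cdot> \<pi> s) = proj T b \<cdot> \<pi> s" using proj_rep[OF U, of b s] base T by simp
  finally show ?case using base proj_closed[of T b] by (simp add: x B.U.m_assoc)
next
  case (mult x y)
  have "proj T (b \<cdot> x \<cdot> y) = proj T b \<cdot> x \<cdot> y" using mult by simp
  then show ?case using mult proj_closed[of T b] by (simp add: B.U.m_assoc)
qed (simp_all add: proj_zero proj_add proj_smult proj_closed B.U.r_distr B.alg_smult_r)

text \<open>Splitting off \<open>\<pi> s\<close> shifts the degree set, and writing a as 1 times a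
  reduces the rest to the projection of the unit: the identity lies in the shifted set exactly when
  s lies in T.\<close>

lemma proj_homogeneous:
  assumes [simp]: "s \<in> carrier S" and a: "a \<in> X s" and T: "saturated T"
  shows "proj T (a \<cdot> \<pi> s) = (if s \<in> T then a \<cdot> \<pi> s else \<zero>\<^bsub>B\<^esub>)"
proof -
  have [simp]: "a \<in> A" using X_A[OF _ a] by simp
  have U: "saturated {u \<in> carrier S. u \<otimes> s \<in> T}" using T by (intro saturated_right_quot) auto
  have "proj {u \<in> carrier S. u \<otimes> s \<in> T} (\<one>\<^bsub>B\<^esub> \<cdot> a) = (if s \<in> T then a else \<zero>\<^bsub>B\<^esub>)"
    by (subst proj_A) (use U in \<open>auto simp: proj_one\<close>)
  then show ?thesis using proj_rep[OF T, of a s] by simp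
qed

lemma proj_rep_sum:
  assumes "f \<in> FS" and T: "saturated T"
  shows "proj T (\<Phi> f) = \<Phi> (\<lambda>s. if s \<in> T then f s else \<zero>\<^bsub>B\<^esub>)"
  using assms(1)
proof (induction f rule: L.FS_induct)
  case zero
  then show ?case using T by (simp add: rep_sum_zero proj_zero)
next
  case (single s a)
  have "(\<lambda>t. if t \<in> T then single_at B a s t else \<zero>\<^bsub>B\<^esub>) =
    (if s \<in> T then single_at B a s else (\<lambda>t. \<zero>\<^bsub>B\<^esub>))"
    by (auto simp: single_at_def)
  then show ?case using single T by (simp add: rep_sum_single proj_homogeneous rep_sum_zero)
next
  case (add f g)
  have "(\<lambda>s. if s \<in> T then f s \<oplus>\<^bsub>B\<^esub> g s else \<zero>\<^bsub>B\<^esub>) =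
    (\<lambda>s. (if s \<in> T then f s else \<zero>\<^bsub>B\<^esub>) \<oplus>\<^bsub>B\<^esub> (if s \<in> T then g s else \<zero>\<^bsub>B\<^esub>))"
    by auto
  then show ?case using add T by (simp add: rep_sum_add rep_sum_closed proj_add L.FS_restrict)
qed

text \<open>Two indices of one class have a common lower bound r, and the coefficient is admissible
  at all three because the ideals are constant along the order. The difference wanted is the
  relation for r and t minus the relation for r and s.\<close>

lemma single_diff_mem:
  assumes J: "submodule J K L" "rels \<subseteq> J" and st: "s \<in> carrier S" "t \<in> min_class s" "a \<in> X s"
  shows "single_at B a s \<ominus>\<^bsub>L\<^esub> single_at B a t \<in> J"
    and "single_at B a t \<in> FS" "\<pi> s = \<pi> t" "t \<in> carrier S" "a \<in> X t"
proof -
  obtain r where r: "r \<in> carrier S" "nat_le S r s" "nat_le S r t" and t: "t \<in> carrier S"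
    using st unfolding min_class_def by blast
  have X: "a \<in> X r" "a \<in> X t" using X_nat_le[of r s] X_nat_le[of r t] r st t by auto
  have "single_at B a r \<ominus>\<^bsub>L\<^esub> single_at B a t \<in> J" "single_at B a r \<ominus>\<^bsub>L\<^esub> single_at B a s \<in> J"
    using J(2) r st(1) t X unfolding single_alg by blast+
  then have "(single_at B a r \<ominus>\<^bsub>L\<^esub> single_at B a t) \<oplus>\<^bsub>L\<^esub> (\<ominus>\<^bsub>L\<^esub> (single_at B a r \<ominus>\<^bsub>L\<^esub> single_at B a s)) \<in> J"
    using L_mod.submoduleE(3,5)[OF J(1)] by blast
  moreover have "x \<in> carrier L \<Longrightarrow> y \<in> carrier L \<Longrightarrow> z \<in> carrier L \<Longrightarrow>
      (x \<ominus>\<^bsub>L\<^esub> z) \<oplus>\<^bsub>L\<^esub> (\<ominus>\<^bsub>L\<^esub> (x \<ominus>\<^bsub>L\<^esub> y)) = y \<ominus>\<^bsub>L\<^esub> z" for x y z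
    by (simp add: a_minus_def L_mod.M.minus_add L_mod.M.a_ac L_mod.M.r_neg1 L_mod.M.r_neg2)
  ultimately show "single_at B a s \<ominus>\<^bsub>L\<^esub> single_at B a t \<in> J"
    using X st t r by (simp add: L_sel(1) L.FS_single)
  show "single_at B a t \<in> FS" "t \<in> carrier S" "a \<in> X t" using X t L.FS_single by auto
  show "\<pi> s = \<pi> t" using rep_nat_le[of r s] rep_nat_le[of r t] r st t by simp
qed

text \<open>Modulo the defining relations, terms whose indices lie in the same class of the minimum group
  congruence can be collected into one; the projections then show that every coefficient vanishes.\<close>

lemma ker_subset:
  assumes J: "submodule J K L" "rels \<subseteq> J" and f: "f \<in> FS" "\<Phi> f = \<zero>\<^bsub>B\<^esub>"
  shows "f \<in> J"
  using f
proof (induction "card {s. f s \<noteq> \<zero>\<^bsub>B\<^esub>}" arbitrary: f rule: less_induct)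
  case less
  note f = less.prems
  show ?case
  proof (cases "\<exists>s t. f s \<noteq> \<zero>\<^bsub>B\<^esub> \<and> f t \<noteq> \<zero>\<^bsub>B\<^esub> \<and> s \<noteq> t \<and> t \<in> min_class s")
    case True
    then obtain s t where st: "f s \<noteq> \<zero>\<^bsub>B\<^esub>" "f t \<noteq> \<zero>\<^bsub>B\<^esub>" "s \<noteq> t" "t \<in> min_class s" by blast
    define a y z where "a = f s" and "y = single_at B a s" and "z = single_at B a t"
    have s: "s \<in> carrier S" using st f L.FS_outside by blast
    have a: "a \<in> X s" unfolding a_def using f s L.FS_D by blast
    note * = single_diff_mem[OF J s st(4) a, folded y_def z_def]
    have y: "y \<in> FS" unfolding y_def using s a by (simp add: L.FS_single)
    have yz: "y \<ominus>\<^bsub>L\<^esub> z \<in> FS" using y *(2) L_mod.M.minus_closed unfolding L_sel(1) by blast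
    \<comment> \<open>The subtraction moves the coefficient a from index s to index t. Since t
      already carries a nonzero coefficient, no index is gained while s is lost, so the support
      shrinks.\<close>
    define g where "g = f \<ominus>\<^bsub>L\<^esub> (y \<ominus>\<^bsub>L\<^esub> z)"
    have g: "g \<in> FS" unfolding g_def using f yz L_mod.M.minus_closed unfolding L_sel(1) by blast
    have fg: "f = g \<oplus>\<^bsub>L\<^esub> (y \<ominus>\<^bsub>L\<^esub> z)"
      using f yz unfolding g_def
      by (simp add: a_minus_def[of _ f] L_mod.M.a_assoc L_mod.M.l_neg flip: L_sel(1))
    have "\<Phi> y = \<Phi> z" unfolding y_def z_def using * s a by (simp add: rep_sum_single)
    then have "\<Phi> (y \<ominus>\<^bsub>L\<^esub> z) = \<zero>\<^bsub>B\<^esub>"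
      using rep_sum_minus[OF y *(2)] rep_sum_closed[OF yz] rep_sum_closed[OF *(2)] by simp
    then have "\<Phi> g = \<zero>\<^bsub>B\<^esub>"
      using rep_sum_minus[OF f(1) yz] f(2) rep_sum_closed[OF g] by (simp flip: g_def)
    have g_eq: "g u = f u \<ominus>\<^bsub>alg\<^esub> (y u \<ominus>\<^bsub>alg\<^esub> z u)" for u
      unfolding g_def using L.a_minus_FS[of L f "y \<ominus>\<^bsub>L\<^esub> z"] L.a_minus_FS[of L y z] f(1) yz y *(2)
      by (simp add: L_sel)
    have aA: "a \<in> A" using X_A a s by simp
    \<comment> \<open>Both values of g computed below have this shape: x is a at the index s, and 0
      at an index where f vanishes, which is neither s nor t.\<close>
    have sub: "x \<ominus>\<^bsub>alg\<^esub> (x \<ominus>\<^bsub>alg\<^esub> \<zero>\<^bsub>B\<^esub>) = \<zero>\<^bsub>B\<^esub>" if "x \<in> A" for x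
      using L.minus_minus_zero that by simp
    have "g s = \<zero>\<^bsub>B\<^esub>"
      using sub[OF aA] st(3) by (simp add: g_eq y_def z_def single_at_def a_def)
    moreover have "g u = \<zero>\<^bsub>B\<^esub>" if "f u = \<zero>\<^bsub>B\<^esub>" for u
      using that st sub[OF A_zero] by (auto simp: g_eq y_def z_def single_at_def)
    ultimately have "{u. g u \<noteq> \<zero>\<^bsub>B\<^esub>} \<subset> {u. f u \<noteq> \<zero>\<^bsub>B\<^esub>}" using st(1) by blast
    then have "card {u. g u \<noteq> \<zero>\<^bsub>B\<^esub>} < card {u. f u \<noteq> \<zero>\<^bsub>B\<^esub>}"
      using L.FS_finite[OF f(1)] by (rule psubset_card_mono[rotated])
    then have "g \<in> J" using less.hyps g \<open>\<Phi> g = \<zero>\<^bsub>B\<^esub>\<close> by blast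
    then show ?thesis using fg *(1) L_mod.submoduleE(5)[OF J(1)] by metis
  next
    case False
    have "f s = \<zero>\<^bsub>B\<^esub>" for s
    proof (rule ccontr)
      assume s: "f s \<noteq> \<zero>\<^bsub>B\<^esub>"
      then have [simp]: "s \<in> carrier S" using f L.FS_outside by blast
      have fs: "f s \<in> X s" using f L.FS_D by simp
      have [simp]: "f s \<in> carrier B" using f FS_B by simp
      \<comment> \<open>The class of s carries no coefficient except the one at s, so projecting f
        to it leaves a single term.\<close>
      have "f t = \<zero>\<^bsub>B\<^esub>" if "t \<in> min_class s" "t \<noteq> s" for t using False s that by blast
      then have "(\<lambda>t. if t \<in> min_class s then f t else \<zero>\<^bsub>B\<^esub>) = single_at B (f s) s"
        using min_class_refl[of s] by (intro ext) (auto simp: single_at_def)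
      then have "f s \<cdot> \<pi> s = proj (min_class s) (\<Phi> f)"
        using f(1) fs by (simp add: proj_rep_sum saturated_min_class rep_sum_single)
      also have "\<dots> = \<zero>\<^bsub>B\<^esub>" using f by (simp add: proj_zero saturated_min_class)
      finally have "f s \<cdot> \<epsilon> s = \<zero>\<^bsub>B\<^esub>" by (simp add: rep_eps_def flip: B.U.m_assoc)
      then show False using s X_eps_right[OF _ fs] by simp
    qed
    then have "f = \<zero>\<^bsub>L\<^esub>" by (auto simp: L_sel)
    moreover have "\<zero>\<^bsub>L\<^esub> \<in> J" using J(1) subgroup.one_closed[of J] by (fastforce simp: submodule_def)
    ultimately show ?thesis by simp
  qed
qed

text \<open>Since \<open>ker_subset\<close> covers every submodule that contains the relations, the
  ideal they generate is already their linear span.\<close>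

lemma crossed_ideal_eq_ker: "crossed_ideal K S alg X \<alpha> = ker"
proof
  show "crossed_ideal K S alg X \<alpha> \<subseteq> ker"
    unfolding crossed_ideal_def by (rule gen_alg_ideal_least[OF alg_ideal_ker rels_ker])
  show "ker \<subseteq> crossed_ideal K S alg X \<alpha>"
    unfolding crossed_ideal_def gen_alg_ideal_def alg_ideal_def using ker_subset by blast
qed

text \<open>The image is a submodule closed under right multiplication by every
  \<open>\<pi> s\<close>, and it contains the unit as the value of the single term 1 at the index
  1.\<close>

lemma rep_sum_onto: "\<Phi> ` carrier L = carrier B"
proof
  show "\<Phi> ` carrier L \<subseteq> carrier B" using rep_sum_closed by (auto simp: L_sel)
  show "carrier B \<subseteq> \<Phi> ` carrier L"
    unfolding L_sel
  proof (rule generated[OF submodule_rep_sum_image])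
    have "\<Phi> (single_at B \<one>\<^bsub>B\<^esub> \<one>) = \<one>\<^bsub>B\<^esub>" "\<one>\<^bsub>B\<^esub> \<in> X \<one>"
      using rep_sum_single[of \<one> "\<one>\<^bsub>B\<^esub>"] by (auto simp: X_iff A_one eps_one rep_one)
    then show "\<one>\<^bsub>B\<^esub> \<in> \<Phi> ` FS" using L.FS_single[of \<one> "\<one>\<^bsub>B\<^esub>"] by (metis S.one_closed imageI)
  qed (use rep_sum_image_mult in force)
qed

theorem rep_phi_iso:
  shows "f \<in> carrier L \<Longrightarrow> rep_phi B \<pi> (crossed_ideal K S alg X \<alpha> +>\<^bsub>L\<^esub> f) = \<Phi> f"
    and "rep_phi B \<pi> \<in> alg_iso K (crossed_product K S alg X \<alpha>) B"
proof -
  have mult: "f \<otimes>\<^bsub>L\<^esub> g \<in> carrier L" if "f \<in> carrier L" "g \<in> carrier L" for f g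
    using that L.conv_closed by (simp add: L_sel)
  note iso = quot_algebra_kernel_iso[OF L_mod.M.abelian_group_axioms M.abelian_group_axioms,
      where h = \<Phi> and K = K and I = ker, OF mult L_mod.smult_closed rep_sum_onto]
  show "f \<in> carrier L \<Longrightarrow> rep_phi B \<pi> (crossed_ideal K S alg X \<alpha> +>\<^bsub>L\<^esub> f) = \<Phi> f"
    unfolding crossed_ideal_eq_ker rep_phi_def
    by (rule iso(1)) (use rep_sum_mult in \<open>auto simp: L_sel rep_sum_add rep_sum_smult\<close>)
  show "rep_phi B \<pi> \<in> alg_iso K (crossed_product K S alg X \<alpha>) B"
    unfolding crossed_product_def crossed_ideal_eq_ker rep_phi_def[abs_def]
    by (rule iso(2)) (use rep_sum_mult in \<open>auto simp: L_sel rep_sum_add rep_sum_smult\<close>)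
qed

end


section \<open>The universal semigroup and the partial semigroup algebra\<close>

context inverse_monoid
begin

section \<open>Words modulo the defining relations\<close>

lemma words_append: "u \<in> words S \<Longrightarrow> v \<in> words S \<Longrightarrow> u @ v \<in> words S"
  by (auto simp: words_def)

lemma words_single: "s \<in> carrier S \<Longrightarrow> [s] \<in> words S"
  by (simp add: words_def)

lemma pr_eq_words: "pr_eq S u v \<Longrightarrow> u \<in> words S \<and> v \<in> words S"
  by (induction rule: pr_eq.induct) (auto simp: words_def)

lemma pr_class_eqI: "pr_eq S u v \<Longrightarrow> pr_class S u = pr_class S v"
  unfolding pr_class_def using pr_eq.sym pr_eq.trans by blast

lemma carrier_Pr: "carrier (Pr S) = pr_class S ` words S"
  by (auto simp: Pr_def quotient_def pr_class_def)

lemma Pr_mult: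
  assumes "u \<in> words S" "v \<in> words S"
  shows "pr_class S u \<otimes>\<^bsub>Pr S\<^esub> pr_class S v = pr_class S (u @ v)"
proof -
  have "pr_class S (u' @ v') = pr_class S (u @ v)" if "u' \<in> pr_class S u" "v' \<in> pr_class S v" for u' v'
    using that by (intro pr_class_eqI pr_eq.append) (auto simp: pr_class_def pr_eq.sym)
  moreover have "u \<in> pr_class S u" "v \<in> pr_class S v"
    using assms by (auto simp: pr_class_def pr_eq.refl)
  ultimately have "(\<Union>u' \<in> pr_class S u. \<Union>v' \<in> pr_class S v. pr_class S (u' @ v')) = pr_class S (u @ v)"
    by blast
  then show ?thesis by (simp add: Pr_def)
qed

text \<open>That [1] is a unit is a consequence of the relations: a letter s is expanded to the word
  \<open>[s, s\<^sup>\<star>, s]\<close>, whose first two or last two letters then absorb 1 by the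
  right or left relation. Longer words follow from their first or last letter.\<close>

lemma pr_class_one:
  assumes "u \<in> words S"
  shows "pr_class S ([\<one>] @ u) = pr_class S u" "pr_class S (u @ [\<one>]) = pr_class S u"
proof -
  have left: "pr_eq S [\<one>, s] [s]" if [simp]: "s \<in> carrier S" for s
  proof -
    have reg: "pr_eq S [s, s\<^sup>\<star>, s] [s]" by (rule pr_eq.rel_regular) simp
    have "pr_eq S ([\<one>] @ [s]) ([\<one>] @ [s, s\<^sup>\<star>, s])"
      using reg by (intro pr_eq.append pr_eq.refl words_single pr_eq.sym[OF reg]) simp
    moreover have "pr_eq S ([\<one>, s, s\<^sup>\<star>] @ [s]) ([s, s\<^sup>\<star>] @ [s])"
      using pr_eq.rel_right[of \<one> S s] by (intro pr_eq.append pr_eq.refl words_single) simp_all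
    ultimately show ?thesis using reg pr_eq.trans by (metis append_Cons append_Nil)
  qed
  have right: "pr_eq S [s, \<one>] [s]" if [simp]: "s \<in> carrier S" for s
  proof -
    have reg: "pr_eq S [s, s\<^sup>\<star>, s] [s]" by (rule pr_eq.rel_regular) simp
    have "pr_eq S ([s] @ [\<one>]) ([s, s\<^sup>\<star>, s] @ [\<one>])"
      by (intro pr_eq.append pr_eq.refl words_single pr_eq.sym[OF reg]) simp
    moreover have "pr_eq S ([s] @ [s\<^sup>\<star>, s, \<one>]) ([s] @ [s\<^sup>\<star>, s])"
      using pr_eq.rel_left[of s S \<one>] by (intro pr_eq.append pr_eq.refl words_single) simp_all
    ultimately show ?thesis using reg pr_eq.trans by (metis append_Cons append_Nil)
  qed
  obtain s v where u: "u = s # v" "s \<in> carrier S" "v = [] \<or> v \<in> words S"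
    using assms by (cases u) (auto simp: words_def)
  have "pr_eq S ([\<one>, s] @ v) ([s] @ v)"
    using u left[of s] pr_eq.append[OF left[of s] pr_eq.refl[of v]] by (auto simp del: append_Cons)
  then show "pr_class S ([\<one>] @ u) = pr_class S u" using u by (intro pr_class_eqI) simp
  obtain t w where w: "u = w @ [t]" "t \<in> carrier S" "w = [] \<or> w \<in> words S"
    using assms by (cases u rule: rev_cases) (auto simp: words_def)
  have "pr_eq S (w @ [t, \<one>]) (w @ [t])"
    using w right[of t] pr_eq.append[OF pr_eq.refl[of w] right[of t]] by auto
  then show "pr_class S (u @ [\<one>]) = pr_class S u" using w by (intro pr_class_eqI) simp
qed

lemma one_Pr: "\<one>\<^bsub>Pr S\<^esub> = pr_class S [\<one>]"
  by (simp add: Pr_def)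

lemma monoid_Pr: "Group.monoid (Pr S)"
  by (rule monoidI) (auto simp: carrier_Pr one_Pr Pr_mult words_append words_single
    pr_class_one[simplified])

section \<open>The degree of a class of words\<close>

definition word_prod :: "'a list \<Rightarrow> 'a" where
  "word_prod u = foldr (\<otimes>) u \<one>"

lemma word_prod_closed: "u \<in> lists (carrier S) \<Longrightarrow> word_prod u \<in> carrier S"
  by (induction u) (auto simp: word_prod_def)

lemma word_prod_append:
  "u \<in> lists (carrier S) \<Longrightarrow> v \<in> lists (carrier S) \<Longrightarrow> word_prod (u @ v) = word_prod u \<otimes> word_prod v"
proof (induction u)
  case Nil
  then show ?case using word_prod_closed[of v] by (simp add: word_prod_def)
next
  case (Cons s u)
  then show ?case using word_prod_closed[of u] word_prod_closed[of v]
    by (simp add: word_prod_def m_assoc)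
qed

lemma pr_eq_word_prod: "pr_eq S u v \<Longrightarrow> word_prod u = word_prod v"
proof (induction rule: pr_eq.induct)
  case (append u v x y)
  then show ?case using pr_eq_words[of u v] pr_eq_words[of x y]
    by (simp add: words_def word_prod_append)
next
  case (rel_regular s)
  then show ?case using star_props(2)[of s] by (simp add: word_prod_def m_assoc)
qed (simp_all add: word_prod_def m_assoc)

text \<open>The defining relations of \<open>Pr S\<close> preserve products, so multiplying out words is a grading
  of \<open>Pr S\<close> by \<open>S\<close>.\<close>

definition degree :: "'a list set \<Rightarrow> 'a" where
  "degree p = the_elem (word_prod ` p)"

lemma degree_class:
  assumes "u \<in> words S" shows "degree (pr_class S u) = word_prod u"
proof -
  have "u \<in> pr_class S u" using assms by (simp add: pr_class_def pr_eq.refl)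
  moreover have "word_prod v = word_prod u" if "v \<in> pr_class S u" for v
    using pr_eq_word_prod[of u v] that by (simp add: pr_class_def)
  ultimately have "word_prod ` pr_class S u = {word_prod u}" by blast
  then show ?thesis by (simp add: degree_def)
qed

lemma degree_closed: "p \<in> carrier (Pr S) \<Longrightarrow> degree p \<in> carrier S"
  by (auto simp: carrier_Pr degree_class) (simp add: words_def word_prod_closed)

lemma degree_mult:
  "p \<in> carrier (Pr S) \<Longrightarrow> q \<in> carrier (Pr S) \<Longrightarrow> degree (p \<otimes>\<^bsub>Pr S\<^esub> q) = degree p \<otimes> degree q"
  by (auto simp: carrier_Pr Pr_mult degree_class words_append word_prod_append)
    (auto simp: words_def word_prod_append)

lemma degree_single: "s \<in> carrier S \<Longrightarrow> degree (pr_class S [s]) = s"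
  by (simp add: degree_class words_single word_prod_def)

end

section \<open>The partial semigroup algebra and the ideal \<open>J\<close>\<close>

locale partial_semigroup_algebra = S?: inverse_monoid S + K?: field K
  for S :: "('s, 'n) monoid_scheme" (structure) and K :: "('k, 'm) ring_scheme" (structure)
begin

abbreviation KS where "KS \<equiv> Kpar K S"
abbreviation mult_KS (infixl "\<cdot>" 70) where "x \<cdot> y \<equiv> x \<otimes>\<^bsub>KS\<^esub> y"
abbreviation FS where "FS \<equiv> fin_supp K (carrier (Pr S)) (\<lambda>p. carrier K)"
abbreviation J where "J \<equiv> J_ideal K S"
abbreviation \<iota> where "\<iota> \<equiv> iota K S"

sublocale Pr: monoid_algebra K "Pr S"
  rewrites "semigroup_algebra K (Pr S) = Kpar K S"
  by (intro monoid_algebra.intro K.field_axioms monoid_Pr) (simp add: Kpar_def)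

sublocale KS: unital_algebra K "Kpar K S"
  using Pr.unital_algebra_KP .

lemmas KS_sel = Pr.KP_sel

lemma Pr_closed: "s \<in> carrier S \<Longrightarrow> pr_class S [s] \<in> carrier (Pr S)"
  by (simp add: carrier_Pr words_single)

lemma iota_closed: "s \<in> carrier S \<Longrightarrow> \<iota> s \<in> carrier KS"
  by (simp add: iota_def KS_sel Pr.FS_single Pr_closed)

lemma single_mult:
  assumes "u \<in> words S" "v \<in> words S"
  shows "single_at K \<one>\<^bsub>K\<^esub> (pr_class S u) \<cdot> single_at K \<one>\<^bsub>K\<^esub> (pr_class S v) =
    single_at K \<one>\<^bsub>K\<^esub> (pr_class S (u @ v))"
  using assms by (simp add: KS_sel Pr.conv_single_single carrier_Pr Pr_mult)

lemma partial_rep_iota: "partial_rep S KS \<iota>"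
  unfolding partial_rep_def
proof (intro conjI ballI)
  fix s t assume [simp]: "s \<in> carrier S" "t \<in> carrier S"
  have w: "[x, y] \<in> words S" if "x \<in> carrier S" "y \<in> carrier S" for x y
    using that by (auto simp: words_def)
  show "\<iota> (s\<^sup>\<star>) \<cdot> \<iota> s \<cdot> \<iota> t = \<iota> (s\<^sup>\<star>) \<cdot> \<iota> (s \<otimes> t)"
    "\<iota> s \<cdot> \<iota> t \<cdot> \<iota> (t\<^sup>\<star>) = \<iota> (s \<otimes> t) \<cdot> \<iota> (t\<^sup>\<star>)"
    "\<iota> s \<cdot> \<iota> (s\<^sup>\<star>) \<cdot> \<iota> s = \<iota> s"
    using pr_class_eqI[OF pr_eq.rel_left[of s S t]] pr_class_eqI[OF pr_eq.rel_right[of s S t]]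
      pr_class_eqI[OF pr_eq.rel_regular[of s S]]
    by (simp_all add: iota_def single_mult words_single w)
qed (use iota_closed in auto)

lemma one_KS: "\<one>\<^bsub>KS\<^esub> = \<iota> \<one>"
  by (simp add: KS_sel iota_def one_Pr)

abbreviation J_rels where
  "J_rels \<equiv> {a \<cdot> \<iota> s \<ominus>\<^bsub>KS\<^esub> a \<cdot> \<iota> t | a s t.
     a \<in> carrier KS \<and> s \<in> carrier S \<and> t \<in> carrier S \<and> nat_le S s t}"

lemma J_rels_carrier: "J_rels \<subseteq> carrier KS"
  using iota_closed by auto

lemma alg_ideal_J: "alg_ideal K KS J"
  unfolding J_ideal_def by (rule KS.alg_ideal_gen(1)[OF J_rels_carrier])

lemma J_rels_J: "J_rels \<subseteq> J"
  unfolding J_ideal_def by (rule KS.alg_ideal_gen(2)[OF J_rels_carrier])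

text \<open>This is the sum of the components whose degree lies in T, written as membership in a set
  of classes so that it is an instance of \<open>FS_restrict\<close>.\<close>

definition restr :: "'s set \<Rightarrow> ('s list set \<Rightarrow> 'k) \<Rightarrow> ('s list set \<Rightarrow> 'k)" where
  "restr T f = (\<lambda>p. if p \<in> {p. degree p \<in> T} then f p else \<zero>\<^bsub>K\<^esub>)"

lemma restr_closed: "f \<in> FS \<Longrightarrow> restr T f \<in> FS"
  unfolding restr_def by (rule Pr.FS_restrict)

lemma restr_zero: "restr T (\<lambda>p. \<zero>\<^bsub>K\<^esub>) = (\<lambda>p. \<zero>\<^bsub>K\<^esub>)"
  by (simp add: restr_def)

lemma restr_single: "restr T (single_at K c p) = (if degree p \<in> T then single_at K c p else (\<lambda>p. \<zero>\<^bsub>K\<^esub>))"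
  by (auto simp: restr_def single_at_def)

lemma restr_add: "f \<in> FS \<Longrightarrow> g \<in> FS \<Longrightarrow>
    restr T (\<lambda>p. f p \<oplus>\<^bsub>K\<^esub> g p) = (\<lambda>p. restr T f p \<oplus>\<^bsub>K\<^esub> restr T g p)"
  by (auto simp: restr_def)

lemma restr_smult: "c \<in> carrier K \<Longrightarrow> restr T (\<lambda>p. c \<otimes>\<^bsub>K\<^esub> f p) = (\<lambda>p. c \<otimes>\<^bsub>K\<^esub> restr T f p)"
  by (auto simp: restr_def)

lemma restr_minus:
  assumes "f \<in> FS" "g \<in> FS" shows "restr T (f \<ominus>\<^bsub>KS\<^esub> g) = restr T f \<ominus>\<^bsub>KS\<^esub> restr T g"
  using assms by (simp add: Pr.a_minus_FS[of KS] KS_sel restr_closed)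
    (auto simp: restr_def a_minus_def)

text \<open>Degrees multiply, so a product with a term of degree d has its degree in T exactly when
  the other factor has its degree in the quotient of T by d.\<close>

lemma restr_mult_single:
  assumes "f \<in> FS" and p: "p \<in> carrier (Pr S)" "c \<in> carrier K"
  shows "restr T (f \<cdot> single_at K c p) = restr {u \<in> carrier S. u \<otimes> degree p \<in> T} f \<cdot> single_at K c p"
    and "restr T (single_at K c p \<cdot> f) = single_at K c p \<cdot> restr {u \<in> carrier S. degree p \<otimes> u \<in> T} f"
proof -
  have "restr T (f \<cdot> single_at K c p) = restr {u \<in> carrier S. u \<otimes> degree p \<in> T} f \<cdot> single_at K c p \<and>
    restr T (single_at K c p \<cdot> f) = single_at K c p \<cdot> restr {u \<in> carrier S. degree p \<otimes> u \<in> T} f"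
    using assms(1) unfolding KS_sel
  proof (induction f rule: Pr.FS_induct)
    case zero
    then show ?case by (simp add: restr_zero Pr.conv_simps)
  next
    case (single q b)
    then show ?case using p
      by (simp add: Pr.conv_simps restr_single degree_mult degree_closed)
  next
    case (add f g)
    then show ?case using p by (simp add: Pr.conv_simps restr_add restr_closed)
  qed
  then show "restr T (f \<cdot> single_at K c p) = restr {u \<in> carrier S. u \<otimes> degree p \<in> T} f \<cdot> single_at K c p"
    "restr T (single_at K c p \<cdot> f) = single_at K c p \<cdot> restr {u \<in> carrier S. degree p \<otimes> u \<in> T} f"
    by auto
qed

lemma J_carrier: "x \<in> J \<Longrightarrow> x \<in> FS"
  and J_zero: "(\<lambda>p. \<zero>\<^bsub>K\<^esub>) \<in> J"
  and J_add: "x \<in> J \<Longrightarrow> y \<in> J \<Longrightarrow> (\<lambda>p. x p \<oplus>\<^bsub>K\<^esub> y p) \<in> J"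
  and J_smult: "c \<in> carrier K \<Longrightarrow> x \<in> J \<Longrightarrow> (\<lambda>p. c \<otimes>\<^bsub>K\<^esub> x p) \<in> J"
  and J_mult: "a \<in> FS \<Longrightarrow> x \<in> J \<Longrightarrow> a \<cdot> x \<in> J" "a \<in> FS \<Longrightarrow> x \<in> J \<Longrightarrow> x \<cdot> a \<in> J"
proof -
  have sub: "submodule J K KS" using alg_ideal_J by (simp add: alg_ideal_def)
  show "x \<in> FS" if "x \<in> J" using KS.submoduleE(1)[OF sub] that by (auto simp: KS_sel)
  show "(\<lambda>p. \<zero>\<^bsub>K\<^esub>) \<in> J"
    using subgroup.one_closed[of J "add_monoid KS"] sub by (simp add: submodule_def KS_sel)
  show "(\<lambda>p. x p \<oplus>\<^bsub>K\<^esub> y p) \<in> J" if "x \<in> J" "y \<in> J"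
    using KS.submoduleE(5)[OF sub that] by (simp add: KS_sel)
  show "(\<lambda>p. c \<otimes>\<^bsub>K\<^esub> x p) \<in> J" if "c \<in> carrier K" "x \<in> J"
    using KS.submoduleE(4)[OF sub that] by (simp add: KS_sel)
  show "a \<cdot> x \<in> J" "x \<cdot> a \<in> J" if "a \<in> FS" "x \<in> J"
    using alg_ideal_J that by (auto simp: alg_ideal_def KS_sel)
qed

text \<open>\<open>J\<close> is a graded ideal for the coarsening of the grading to the maximal group image of \<open>S\<close>.\<close>

lemma restr_J:
  assumes "x \<in> J" "saturated T" shows "restr T x \<in> J"
proof -
  \<comment> \<open>It suffices that the elements of \<open>J\<close> with all their components in
    \<open>J\<close> form an ideal containing the generators. All T are treated at once because
    multiplication by a homogeneous element replaces T by a translate.\<close>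
  define J' where "J' = {x \<in> J. \<forall>T. saturated T \<longrightarrow> restr T x \<in> J}"
  have mult: "\<forall>T. saturated T \<longrightarrow> restr T (a \<cdot> x) \<in> J \<and> restr T (x \<cdot> a) \<in> J" if "a \<in> FS" and x: "x \<in> J'" for a x
    using that(1)
  proof (induction a rule: Pr.FS_induct)
    case zero
    then show ?case by (simp add: KS_sel Pr.conv_simps restr_zero J_zero)
  next
    case (single p c)
    have c: "single_at K c p \<in> FS" using single by (rule Pr.FS_single)
    show ?case
    proof (intro allI impI conjI)
      fix T assume T: "saturated T"
      have "x \<in> FS" and r: "restr U x \<in> J" if "saturated U" for U
        using x that J_carrier by (auto simp: J'_def)
      then have "x \<in> FS" using T by blast
      show "restr T (single_at K c p \<cdot> x) \<in> J" "restr T (x \<cdot> single_at K c p) \<in> J"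
        unfolding restr_mult_single[OF \<open>x \<in> FS\<close> single]
        using J_mult(1)[OF c r[OF saturated_left_quot[OF _ T]]]
          J_mult(2)[OF c r[OF saturated_right_quot[OF _ T]]] degree_closed[OF single(1)] by blast+
    qed
  next
    case (add f g)
    have "x \<in> FS" using x J_carrier by (simp add: J'_def)
    then show ?case
      using add by (simp add: KS_sel Pr.conv_simps restr_add J_add)
  qed
  have "alg_ideal K KS J'"
    unfolding alg_ideal_def
  proof (intro conjI KS.submoduleI_smult ballI)
    show "J' \<subseteq> carrier KS" using J_carrier by (auto simp: J'_def KS_sel)
    show "\<zero>\<^bsub>KS\<^esub> \<in> J'" by (simp add: J'_def KS_sel J_zero restr_zero)
    show "x \<oplus>\<^bsub>KS\<^esub> y \<in> J'" if "x \<in> J'" "y \<in> J'" for x y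
      using that J_carrier by (auto simp: J'_def KS_sel J_add restr_add)
    show "c \<odot>\<^bsub>KS\<^esub> x \<in> J'" if "c \<in> carrier K" "x \<in> J'" for c x
      using that by (auto simp: J'_def KS_sel J_smult restr_smult)
    show "a \<cdot> x \<in> J'" "x \<cdot> a \<in> J'" if "a \<in> carrier KS" "x \<in> J'" for a x
      using that mult[of a x] J_mult[of a x] by (auto simp: J'_def KS_sel(1))
  qed
  moreover have "J_rels \<subseteq> J'"
  proof
    fix x assume "x \<in> J_rels"
    then obtain a s t where x: "x = a \<cdot> \<iota> s \<ominus>\<^bsub>KS\<^esub> a \<cdot> \<iota> t"
      and a: "a \<in> FS" and st: "s \<in> carrier S" "t \<in> carrier S" "nat_le S s t"
      by (auto simp: KS_sel(1))
    have "restr T x \<in> J" if T: "saturated T" for T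
    proof -
      \<comment> \<open>Saturation does not separate us from ut. Hence both terms of a generator are
        cut by the same condition on the coefficient a, and the component is again a generator, with
        a restricted.\<close>
      have U: "{u \<in> carrier S. u \<otimes> s \<in> T} = {u \<in> carrier S. u \<otimes> t \<in> T}"
        using st saturatedD[OF T nat_le_mult_left[OF st(3)]] by auto
      have "a \<cdot> \<iota> s \<in> FS" "a \<cdot> \<iota> t \<in> FS"
        using a st iota_closed KS.alg_m_closed by (auto simp: KS_sel(1))
      then have "restr T x = restr {u \<in> carrier S. u \<otimes> t \<in> T} a \<cdot> \<iota> s \<ominus>\<^bsub>KS\<^esub>
          restr {u \<in> carrier S. u \<otimes> t \<in> T} a \<cdot> \<iota> t"
        using a st by (simp add: x restr_minus iota_def restr_mult_single Pr_closed degree_single U)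
      also have "\<dots> \<in> J_rels"
        using restr_closed[OF a] st by (auto simp: KS_sel(1))
      finally show ?thesis using J_rels_J by blast
    qed
    moreover have "x \<in> J" using J_rels_J \<open>x \<in> J_rels\<close> by (rule subsetD)
    ultimately show "x \<in> J'" by (simp add: J'_def)
  qed
  ultimately have "J \<subseteq> J'" unfolding J_ideal_def by (rule gen_alg_ideal_least)
  then show ?thesis using assms by (auto simp: J'_def)
qed

section \<open>The quotient by \<open>J\<close> and its grading\<close>

sublocale Q: algebra_quotient K "Kpar K S" "J_ideal K S"
  rewrites "quot_algebra (Kpar K S) (J_ideal K S) = Kpar_quot K S"
  by (intro algebra_quotient.intro KS.unital_algebra_axioms algebra_quotient_axioms.intro alg_ideal_J)
    (simp add: Kpar_quot_def)

abbreviation B where "B \<equiv> Kpar_quot K S"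
abbreviation coset where "coset x \<equiv> J +>\<^bsub>KS\<^esub> x"
abbreviation \<pi> where "\<pi> \<equiv> iota_quot K S"

lemma pi_coset: "\<pi> s = coset (\<iota> s)"
  by (simp add: iota_quot_def)

lemma collapsed_rep_pi: "collapsed_rep S K B \<pi>"
proof (intro collapsed_rep.intro collapsed_rep_axioms.intro)
  show "inverse_monoid S" by (rule S.inverse_monoid_axioms)
  show "unital_algebra K B" by (rule Q.unital_algebra_Q)
  show "partial_rep S B \<pi>"
    using partial_rep_iota unfolding partial_rep_def
    by (auto simp: pi_coset Q.coset_hom Q.coset_closed iota_closed KS.alg_m_closed)
  show "\<pi> \<one> = \<one>\<^bsub>B\<^esub>" by (simp add: pi_coset Q.coset_one one_KS)
  fix s t assume st: "s \<in> carrier S" "t \<in> carrier S" "nat_le S s t"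
  \<comment> \<open>The generator with coefficient 1 is what identifies the images of s and
    t.\<close>
  have "\<one>\<^bsub>KS\<^esub> \<cdot> \<iota> s \<ominus>\<^bsub>KS\<^esub> \<one>\<^bsub>KS\<^esub> \<cdot> \<iota> t \<in> J_rels" using st KS.U.one_closed by blast
  then have "\<one>\<^bsub>KS\<^esub> \<cdot> \<iota> s \<ominus>\<^bsub>KS\<^esub> \<one>\<^bsub>KS\<^esub> \<cdot> \<iota> t \<in> J" using J_rels_J by blast
  then show "\<pi> s = \<pi> t" using st by (simp add: pi_coset Q.coset_eq_iff iota_closed)
qed

text \<open>An arbitrary representative is chosen; the result does not depend on it for saturated T,
  because taking components preserves \<open>J\<close>.\<close>

definition proj :: "'s set \<Rightarrow> ('s list set \<Rightarrow> 'k) set \<Rightarrow> ('s list set \<Rightarrow> 'k) set" where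
  "proj T b = coset (restr T (SOME x. x \<in> carrier KS \<and> coset x = b))"

lemma proj_coset:
  assumes x: "x \<in> carrier KS" and T: "saturated T"
  shows "proj T (coset x) = coset (restr T x)"
proof -
  define y where "y = (SOME y. y \<in> carrier KS \<and> coset y = coset x)"
  have y: "y \<in> carrier KS" "coset y = coset x"
    unfolding y_def using someI[of "\<lambda>y. y \<in> carrier KS \<and> coset y = coset x" x] x by auto
  have "y \<ominus>\<^bsub>KS\<^esub> x \<in> J" using y x Q.coset_eq_iff by simp
  then have "restr T (y \<ominus>\<^bsub>KS\<^esub> x) \<in> J" using T by (rule restr_J)
  then have "restr T y \<ominus>\<^bsub>KS\<^esub> restr T x \<in> J" using x y by (simp add: restr_minus KS_sel(1))
  then have "coset (restr T y) = coset (restr T x)"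
    using x y by (subst Q.coset_eq_iff) (simp_all add: KS_sel(1) restr_closed)
  then show ?thesis by (simp add: proj_def y_def)
qed

text \<open>A word is built from the unit by appending letters on the right. The universal semigroup
  has no empty word, so a word of one letter starts from the unit of the quotient algebra.\<close>

lemma coset_word_mem:
  assumes M: "\<one>\<^bsub>B\<^esub> \<in> M" "\<And>b s. b \<in> M \<Longrightarrow> s \<in> carrier S \<Longrightarrow> b \<otimes>\<^bsub>B\<^esub> \<pi> s \<in> M"
    and u: "u \<in> lists (carrier S)" "u \<noteq> []"
  shows "coset (single_at K \<one>\<^bsub>K\<^esub> (pr_class S u)) \<in> M"
  using u
proof (induction u rule: rev_induct)
  case (snoc s u)
  have s: "s \<in> carrier S" using snoc by simp
  show ?case
  proof (cases "u = []")
    case True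
    have "\<one>\<^bsub>B\<^esub> \<otimes>\<^bsub>B\<^esub> \<pi> s = \<pi> s" using s by (simp add: pi_coset Q.coset_closed iota_closed)
    then show ?thesis using True M(2)[OF M(1) s] by (simp add: pi_coset iota_def)
  next
    case False
    then have u: "u \<in> words S" using snoc by (auto simp: words_def)
    have "single_at K \<one>\<^bsub>K\<^esub> (pr_class S u) \<in> carrier KS"
      unfolding KS_sel(1) using u by (intro Pr.FS_single) (simp_all add: carrier_Pr)
    then have "coset (single_at K \<one>\<^bsub>K\<^esub> (pr_class S (u @ [s]))) =
        coset (single_at K \<one>\<^bsub>K\<^esub> (pr_class S u)) \<otimes>\<^bsub>B\<^esub> \<pi> s"
      using u s single_mult[OF u words_single[OF s]] iota_closed[OF s]
      by (simp add: pi_coset Q.coset_hom iota_def)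
    then show ?thesis using M(2)[OF _ s] snoc False by simp
  qed
qed simp

lemma graded_rep_pi: "graded_rep S K B \<pi> proj"
proof (intro graded_rep.intro graded_rep_axioms.intro collapsed_rep_pi)
  fix T assume T: "saturated T"
  note simps = Q.carrier_Q proj_coset T Q.coset_hom Q.coset_smult KS_sel(1) restr_closed
  show "proj T b \<in> carrier B" if "b \<in> carrier B" for b
    using that by (auto simp: simps)
  show "proj T (b \<oplus>\<^bsub>B\<^esub> c) = proj T b \<oplus>\<^bsub>B\<^esub> proj T c" if "b \<in> carrier B" "c \<in> carrier B" for b c
  proof -
    obtain x y where xy: "x \<in> carrier KS" "y \<in> carrier KS" "b = coset x" "c = coset y"
      using \<open>b \<in> carrier B\<close> \<open>c \<in> carrier B\<close> by (auto simp: Q.carrier_Q)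
    then have "restr T (x \<oplus>\<^bsub>KS\<^esub> y) = restr T x \<oplus>\<^bsub>KS\<^esub> restr T y" by (simp add: KS_sel restr_add)
    then show ?thesis using xy KS.M.a_closed[of x y] by (simp add: simps)
  qed
  show "proj T (k \<odot>\<^bsub>B\<^esub> b) = k \<odot>\<^bsub>B\<^esub> proj T b" if "k \<in> carrier K" "b \<in> carrier B" for k b
  proof -
    obtain x where x: "x \<in> carrier KS" "b = coset x" using \<open>b \<in> carrier B\<close> by (auto simp: Q.carrier_Q)
    have "restr T (k \<odot>\<^bsub>KS\<^esub> x) = k \<odot>\<^bsub>KS\<^esub> restr T x"
      using \<open>k \<in> carrier K\<close> by (simp add: KS_sel restr_smult)
    then show ?thesis using x \<open>k \<in> carrier K\<close> KS.smult_closed[of k x] by (simp add: simps)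
  qed
  show "proj T \<one>\<^bsub>B\<^esub> = (if \<one> \<in> T then \<one>\<^bsub>B\<^esub> else \<zero>\<^bsub>B\<^esub>)"
    using iota_closed[of \<one>] T
    by (simp add: Q.coset_one Q.zero_Q one_KS proj_coset)
      (simp add: iota_def restr_single degree_single KS_sel)
  show "proj T (b \<otimes>\<^bsub>B\<^esub> \<pi> s) = proj {u \<in> carrier S. u \<otimes> s \<in> T} b \<otimes>\<^bsub>B\<^esub> \<pi> s"
    if b: "b \<in> carrier B" and s: "s \<in> carrier S" for b s
  proof -
    obtain x where x: "x \<in> carrier KS" "b = coset x" using b by (auto simp: Q.carrier_Q)
    have "restr T (x \<cdot> \<iota> s) = restr {u \<in> carrier S. u \<otimes> s \<in> T} x \<cdot> \<iota> s"
      using x s by (simp add: iota_def restr_mult_single Pr_closed degree_single KS_sel(1))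
    then show ?thesis
      using x s T iota_closed[OF s] KS.alg_m_closed[of x "\<iota> s"]
      by (simp add: pi_coset Q.coset_hom proj_coset saturated_right_quot)
        (simp add: Q.coset_hom restr_closed KS_sel(1))
  qed
next
  fix M assume M: "submodule M K B" "\<one>\<^bsub>B\<^esub> \<in> M" "\<And>b s. b \<in> M \<Longrightarrow> s \<in> carrier S \<Longrightarrow> b \<otimes>\<^bsub>B\<^esub> \<pi> s \<in> M"
  interpret QA: assoc_algebra K B by (rule Q.assoc_algebra_Q)
  \<comment> \<open>By linearity f may be taken to be a scalar multiple of one word, which reduces
    generation to \<open>coset_word_mem\<close>.\<close>
  have "coset f \<in> M" if "f \<in> FS" for f
    using that
  proof (induction f rule: Pr.FS_induct)
    case zero
    have "\<zero>\<^bsub>B\<^esub> \<in> M" using subgroup.one_closed[of M] M(1) by (fastforce simp: submodule_def)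
    then show ?case by (simp add: Q.zero_Q KS_sel)
  next
    case (single p c)
    then obtain u where u: "u \<in> words S" "p = pr_class S u" by (auto simp: carrier_Pr)
    have e: "single_at K \<one>\<^bsub>K\<^esub> p \<in> carrier KS" using single by (simp add: KS_sel Pr.FS_single)
    have "single_at K c p = c \<odot>\<^bsub>KS\<^esub> single_at K \<one>\<^bsub>K\<^esub> p"
      using single by (simp add: KS_sel Pr.smult_single)
    then have "coset (single_at K c p) = c \<odot>\<^bsub>B\<^esub> coset (single_at K \<one>\<^bsub>K\<^esub> p)"
      using single e by (simp add: Q.coset_smult)
    moreover have "coset (single_at K \<one>\<^bsub>K\<^esub> p) \<in> M"
      using coset_word_mem[OF M(2,3), of u] u by (simp add: words_def)
    ultimately show ?case using QA.submoduleE(4)[OF M(1)] single by simp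
  next
    case (add f g)
    then have "coset f \<oplus>\<^bsub>B\<^esub> coset g \<in> M" using QA.submoduleE(5)[OF M(1)] by blast
    then show ?case using add by (simp add: Q.coset_hom KS_sel)
  qed
  then show "carrier B \<subseteq> M" by (auto simp: Q.carrier_Q KS_sel(1))
qed

end

theorem theorem2p7:
  fixes K :: "('k, 'm) ring_scheme" and S :: "('s, 'n) monoid_scheme"
  assumes "field K" and "inverse_monoid S"
  shows "let B = Kpar_quot K S;
             \<iota> = iota_quot K S;
             A = rep_alg K S B \<iota>;
             X = rep_dom K S B \<iota>;
             \<alpha> = rep_act S B \<iota>;
             L = formal_sums S A X \<alpha>;
             I = crossed_ideal K S A X \<alpha>;
             \<phi> = rep_phi B \<iota>
         in partial_rep S (Kpar K S) (iota K S) \<and>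
            partial_action K S A X \<alpha> \<and>
            (\<forall>f \<in> carrier L. \<phi> (I +>\<^bsub>L\<^esub> f) = rep_sum B \<iota> f) \<and>
            \<phi> \<in> alg_iso K (crossed_product K S A X \<alpha>) B"
proof -
  interpret partial_semigroup_algebra S K
    by (intro partial_semigroup_algebra.intro assms)
  interpret R: graded_rep S K "Kpar_quot K S" "iota_quot K S" proj
    by (rule graded_rep_pi)
  show ?thesis
    using partial_rep_iota R.partial_action_rep R.rep_phi_iso by (simp add: Let_def)
qed

end
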